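(* Given a $ci$-smooth functional $\varphi:\mathcal{G}\to\mathbb{R}$ and $x(\cdot)\in\mathcal{W}[0,T]$, consider the function $\omega(\tau)=\varphi(\tau,x_\tau(\cdot))$, $\tau\in[0,T]$. Then $\omega(\cdot)$ is continuous on $[0,T]$; $\omega(\cdot)$ is Lipschitz continuous on $[0,\theta]$ for every $\theta\in(0,T)$; and $$\dot\omega(\tau)=\boldsymbol{\partial}_t\varphi(\tau,x_\tau(\cdot))+\langle\boldsymbol{\nabla}\varphi(\tau,x_\tau(\cdot)),\ell(\tau;T,x(\cdot))\rangle\quad\text{for a.e. }\tau\in[0,T].$$
   Context: Data and standing assumptions. $n\in\mathbb{N}$, $T>0$; $\langle\cdot,\cdot\rangle$, $\|\cdot\|$ are the Euclidean inner product and norm on $\mathbb{R}^n$ (induced norm on $\mathbb{R}^{n\times n}$); $\Omega=\{(\tau,\xi)\in[0,T]^2:\tau\ge\xi\}$, $\Omega^\circ=\{(\tau,\xi)\in\Omega:\tau>\xi\}$; $y(\cdot)\in C([0,T],\mathbb{R}^n)$ and a constant $c>0$ are fixed. (1) $K:\Omega^\circ\to\mathbb{R}^{n\times n}$, $K(\tau,\xi)=K_*(\tau,\xi)/(\tau-\xi)^{1-\alpha}$ with $\alpha\in(0,1)$ and continuous $K_*:\Omega\to\mathbb{R}^{n\times n}$ for which there are $\beta\in(0,1]$, $\lambda>0$ with $\|K_*(\tau,\xi)-K_*(\tau,\xi')\|\le\lambda|\xi-\xi'|^\beta$ for all $(\tau,\xi),(\tau,\xi')\in\Omega$. (2) For every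 $t\in(0,T]$, if $\ell\in L_\infty([0,t],\mathbb{R}^n)$ and $\int_0^\tau K(\tau,\xi)\ell(\xi)\,d\xi=0$ for all $\tau\in[0,t]$, then $\ell=0$ a.e. on $[0,t]$. Positions. $x_t(\cdot)$ denotes the restriction of $x$ to $[0,t]$. For $t\in(0,T]$, $\mathcal{W}[0,t]$ is the set of $w:[0,t]\to\mathbb{R}^n$ for which there is $\ell(\cdot)\in L_\infty([0,t],\mathbb{R}^n)$ with $w(\tau)=y(\tau)+\int_0^\tau K(\tau,\xi)\ell(\xi)\,d\xi$ for all $\tau\in[0,t]$; by (2) $\ell$ is unique (a.e.), denoted $\ell(\cdot;t,w(\cdot))$. $\mathcal{W}[0,0]$ consists of the single function $w$ with $w(0)=y(0)$, and $\ell(0;0,w(\cdot)):=0$. $\mathcal{G}=\bigcup_{t\in[0,T]}(\{t\}\times\mathcal{W}[0,t])$ with metric $\operatorname{dist}((t,w),(t',w'))=|t-t'|+\max_{\tau\in[0,T]}\|w(\min\{\tau,t\})-w'(\min\{\tau,t'\})\|$; $\mathcal{G}^\circ=\{(t,w(\cdot))\in\mathcal{G}:t<T\}$; $\mathcal{X}(t,w(\cdot))=\{x(\cdot)\in\mathcal{W}[0,T]:x_t(\cdot)=w(\cdot)\}$; for $k\in\mathbb{N}$, $\mathcal{G}_k=\{(t,w(\cdot))\in\mathcal{G}:\|\ell(\xi;t,w(\cdot))\|\le kc(1+\|w(\xi)\|)\text{ for a.e. }\xi\in[0,t]\}$. Coinvariant derivatives. $\varphi:\mathcal{G}\to\mathbb{R}$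 is $ci$-differentiable at $(t,w(\cdot))\in\mathcal{G}^\circ$ if there are $\boldsymbol{\partial}_t\varphi(t,w(\cdot))\in\mathbb{R}$ and $\boldsymbol{\nabla}\varphi(t,w(\cdot))\in\mathbb{R}^n$ such that for every $x(\cdot)\in\mathcal{X}(t,w(\cdot))$, as $\tau\to t^+$, $\Bigl|\frac{\varphi(\tau,x_\tau(\cdot))-\varphi(t,w(\cdot))}{\tau-t}-\boldsymbol{\partial}_t\varphi(t,w(\cdot))-\bigl\langle\boldsymbol{\nabla}\varphi(t,w(\cdot)),\frac1{\tau-t}\int_t^\tau\ell(\xi;T,x(\cdot))\,d\xi\bigr\rangle\Bigr|\to0$ (these are then unique). $\varphi$ is $ci$-smooth if it is $ci$-differentiable at every point of $\mathcal{G}^\circ$ and, for every $k\in\mathbb{N}$, $\varphi|_{\mathcal{G}_k}$ and the restrictions of $\boldsymbol{\partial}_t\varphi,\boldsymbol{\nabla}\varphi$ to $\mathcal{G}_k\cap\mathcal{G}^\circ$ are continuous. *)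

theory Defs
  imports "HOL-Analysis.Analysis"
begin

definition Omega :: "real \<Rightarrow> (real \<times> real) set" where
  "Omega T = {(\<tau>, \<xi>). 0 \<le> \<xi> \<and> \<xi> \<le> \<tau> \<and> \<tau> \<le> T}"

definition Omega_open :: "real \<Rightarrow> (real \<times> real) set" where
  "Omega_open T = {(\<tau>, \<xi>) \<in> Omega T. \<xi> < \<tau>}"

text \<open>Essentially bounded, Lebesgue measurable functions on the interval from 0 to t. They are
  not identified modulo null sets, and their values outside the interval are irrelevant.\<close>

definition Linf :: "real \<Rightarrow> (real \<Rightarrow> real ^ 'n) set" where
  "Linf t = {l. l \<in> borel_measurable (lebesgue_on {0..t}) \<and>
                (\<exists>C. AE \<xi> in lebesgue_on {0..t}. norm (l \<xi>) \<le> C)}"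

text \<open>The kernel is only meaningful off the diagonal; its value at \<open>\<xi> = \<tau>\<close> does not affect the
  integral.\<close>

definition volterra ::
  "(real \<times> real \<Rightarrow> real ^ 'n ^ 'n) \<Rightarrow> (real \<Rightarrow> real ^ 'n) \<Rightarrow> real \<Rightarrow> real ^ 'n" where
  "volterra K l \<tau> = (LINT \<xi>|lebesgue_on {0..\<tau>}. K (\<tau>, \<xi>) *v l \<xi>)"

definition represents ::
  "(real \<Rightarrow> real ^ 'n) \<Rightarrow> (real \<times> real \<Rightarrow> real ^ 'n ^ 'n) \<Rightarrow> real \<Rightarrow> (real \<Rightarrow> real ^ 'n)
    \<Rightarrow> (real \<Rightarrow> real ^ 'n) \<Rightarrow> bool" where
  "represents y K t w l \<longleftrightarrow> l \<in> Linf t \<and> (\<forall>\<tau>\<in>{0..t}. w \<tau> = y \<tau> + volterra K l \<tau>)"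

text \<open>A function with domain the interval from 0 to t is an extensional HOL function; accordingly,
  \<open>restrict x {0..t}\<close> is the restriction \<open>x\<^sub>t\<close> of a motion \<open>x\<close>.\<close>

definition motions ::
  "(real \<Rightarrow> real ^ 'n) \<Rightarrow> (real \<times> real \<Rightarrow> real ^ 'n ^ 'n) \<Rightarrow> real \<Rightarrow> (real \<Rightarrow> real ^ 'n) set" where
  "motions y K t = {w \<in> extensional {0..t}.
     if t = 0 then w 0 = y 0 else (\<exists>l. represents y K t w l)}"

text \<open>The function \<open>\<ell>(\<cdot>; t, w)\<close>: a choice of representative of a class that is unique modulo null
  sets under the uniqueness assumption on the kernel. It is only used modulo null sets.\<close>

definition ell ::
  "(real \<Rightarrow> real ^ 'n) \<Rightarrow> (real \<times> real \<Rightarrow> real ^ 'n ^ 'n) \<Rightarrow> real \<Rightarrow> (real \<Rightarrow> real ^ 'n)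
    \<Rightarrow> (real \<Rightarrow> real ^ 'n)" where
  "ell y K t w = (if t = 0 then (\<lambda>_. 0) else (SOME l. represents y K t w l))"

definition positions ::
  "real \<Rightarrow> (real \<Rightarrow> real ^ 'n) \<Rightarrow> (real \<times> real \<Rightarrow> real ^ 'n ^ 'n)
    \<Rightarrow> (real \<times> (real \<Rightarrow> real ^ 'n)) set" where
  "positions T y K = (SIGMA t:{0..T}. motions y K t)"

definition positions_before ::
  "real \<Rightarrow> (real \<Rightarrow> real ^ 'n) \<Rightarrow> (real \<times> real \<Rightarrow> real ^ 'n ^ 'n)
    \<Rightarrow> (real \<times> (real \<Rightarrow> real ^ 'n)) set" where
  "positions_before T y K = {(t, w) \<in> positions T y K. t < T}"

text \<open>The guard makes the distance nonnegative on the whole type, as the locale \<open>Metric_space\<close>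
  requires; outside the set of positions the supremum may be unspecified. For two positions the
  supremum is a maximum, because positions are continuous.\<close>

definition pos_dist ::
  "real \<Rightarrow> (real \<Rightarrow> real ^ 'n) \<Rightarrow> (real \<times> real \<Rightarrow> real ^ 'n ^ 'n)
    \<Rightarrow> real \<times> (real \<Rightarrow> real ^ 'n) \<Rightarrow> real \<times> (real \<Rightarrow> real ^ 'n) \<Rightarrow> real" where
  "pos_dist T y K z z' =
     (if z \<in> positions T y K \<and> z' \<in> positions T y K
      then \<bar>fst z - fst z'\<bar> +
           (SUP \<tau>\<in>{0..T}. norm (snd z (min \<tau> (fst z)) - snd z' (min \<tau> (fst z'))))
      else 0)"

definition pos_topology ::
  "real \<Rightarrow> (real \<Rightarrow> real ^ 'n) \<Rightarrow> (real \<times> real \<Rightarrow> real ^ 'n ^ 'n)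
    \<Rightarrow> (real \<times> (real \<Rightarrow> real ^ 'n)) topology" where
  "pos_topology T y K = Metric_space.mtopology (positions T y K) (pos_dist T y K)"

definition extensions ::
  "real \<Rightarrow> (real \<Rightarrow> real ^ 'n) \<Rightarrow> (real \<times> real \<Rightarrow> real ^ 'n ^ 'n) \<Rightarrow> real \<Rightarrow> (real \<Rightarrow> real ^ 'n)
    \<Rightarrow> (real \<Rightarrow> real ^ 'n) set" where
  "extensions T y K t w = {x \<in> motions y K T. restrict x {0..t} = w}"

definition positions_k ::
  "real \<Rightarrow> (real \<Rightarrow> real ^ 'n) \<Rightarrow> (real \<times> real \<Rightarrow> real ^ 'n ^ 'n) \<Rightarrow> real \<Rightarrow> nat
    \<Rightarrow> (real \<times> (real \<Rightarrow> real ^ 'n)) set" where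
  "positions_k T y K c k = {(t, w) \<in> positions T y K.
     AE \<xi> in lebesgue_on {0..t}. norm (ell y K t w \<xi>) \<le> real k * c * (1 + norm (w \<xi>))}"

definition has_ci_derivative ::
  "real \<Rightarrow> (real \<Rightarrow> real ^ 'n) \<Rightarrow> (real \<times> real \<Rightarrow> real ^ 'n ^ 'n)
    \<Rightarrow> (real \<times> (real \<Rightarrow> real ^ 'n) \<Rightarrow> real) \<Rightarrow> real \<times> (real \<Rightarrow> real ^ 'n)
    \<Rightarrow> real \<times> (real ^ 'n) \<Rightarrow> bool" where
  "has_ci_derivative T y K \<phi> = (\<lambda>(t, w) (a, p).
     \<forall>x\<in>extensions T y K t w.
       ((\<lambda>\<tau>. \<bar>(\<phi> (\<tau>, restrict x {0..\<tau>}) - \<phi> (t, w)) / (\<tau> - t) - a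
              - p \<bullet> ((1 / (\<tau> - t)) *\<^sub>R (LINT \<xi>|lebesgue_on {t..\<tau>}. ell y K T x \<xi>))\<bar>)
         \<longlongrightarrow> 0) (at_right t))"

definition ci_differentiable ::
  "real \<Rightarrow> (real \<Rightarrow> real ^ 'n) \<Rightarrow> (real \<times> real \<Rightarrow> real ^ 'n ^ 'n)
    \<Rightarrow> (real \<times> (real \<Rightarrow> real ^ 'n) \<Rightarrow> real) \<Rightarrow> real \<times> (real \<Rightarrow> real ^ 'n) \<Rightarrow> bool" where
  "ci_differentiable T y K \<phi> z \<longleftrightarrow> (\<exists>D. has_ci_derivative T y K \<phi> z D)"

text \<open>The pair of coinvariant derivatives is unique at points where it exists, so the choice is
  immaterial there.\<close>

definition ci_derivs ::
  "real \<Rightarrow> (real \<Rightarrow> real ^ 'n) \<Rightarrow> (real \<times> real \<Rightarrow> real ^ 'n ^ 'n)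
    \<Rightarrow> (real \<times> (real \<Rightarrow> real ^ 'n) \<Rightarrow> real) \<Rightarrow> real \<times> (real \<Rightarrow> real ^ 'n)
    \<Rightarrow> real \<times> (real ^ 'n)" where
  "ci_derivs T y K \<phi> z = (SOME D. has_ci_derivative T y K \<phi> z D)"

definition ci_dt ::
  "real \<Rightarrow> (real \<Rightarrow> real ^ 'n) \<Rightarrow> (real \<times> real \<Rightarrow> real ^ 'n ^ 'n)
    \<Rightarrow> (real \<times> (real \<Rightarrow> real ^ 'n) \<Rightarrow> real) \<Rightarrow> real \<times> (real \<Rightarrow> real ^ 'n) \<Rightarrow> real" where
  "ci_dt T y K \<phi> z = fst (ci_derivs T y K \<phi> z)"

definition ci_grad ::
  "real \<Rightarrow> (real \<Rightarrow> real ^ 'n) \<Rightarrow> (real \<times> real \<Rightarrow> real ^ 'n ^ 'n)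
    \<Rightarrow> (real \<times> (real \<Rightarrow> real ^ 'n) \<Rightarrow> real) \<Rightarrow> real \<times> (real \<Rightarrow> real ^ 'n) \<Rightarrow> real ^ 'n" where
  "ci_grad T y K \<phi> z = snd (ci_derivs T y K \<phi> z)"

definition ci_smooth ::
  "real \<Rightarrow> (real \<Rightarrow> real ^ 'n) \<Rightarrow> (real \<times> real \<Rightarrow> real ^ 'n ^ 'n) \<Rightarrow> real
    \<Rightarrow> (real \<times> (real \<Rightarrow> real ^ 'n) \<Rightarrow> real) \<Rightarrow> bool" where
  "ci_smooth T y K c \<phi> \<longleftrightarrow>
     (\<forall>z\<in>positions_before T y K. ci_differentiable T y K \<phi> z) \<and>
     (\<forall>k. continuous_map
            (subtopology (pos_topology T y K) (positions_k T y K c k))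
            euclidean \<phi> \<and>
          continuous_map
            (subtopology (pos_topology T y K) (positions_k T y K c k \<inter> positions_before T y K))
            euclidean (ci_dt T y K \<phi>) \<and>
          continuous_map
            (subtopology (pos_topology T y K) (positions_k T y K c k \<inter> positions_before T y K))
            euclidean (ci_grad T y K \<phi>))"

end

theory Submission imports Defs begin

text \<open>The function \<open>\<omega>\<close> is the integral of its expected derivative. Let \<open>l\<close> be the essentially
  bounded function that generates the motion \<open>x\<close>, and let \<open>a\<close> and \<open>p\<close> be the coinvariant derivatives of
  \<open>\<phi>\<close> along \<open>x\<close>. All initial segments of \<open>x\<close> lie in a single set \<open>positions_k\<close>
  (\<open>restrict_positions_k\<close>), and they depend continuously on time in the metric of positions
  (\<open>continuous_map_restrict_motion\<close>). Smoothness of \<open>\<phi>\<close> therefore makes \<open>\<omega>\<close> continuous on \<open>[0, T]\<close> and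
  \<open>a\<close>, \<open>p\<close> continuous on \<open>[0, T)\<close>.

  Differentiability of \<open>\<phi>\<close> at the segment of \<open>x\<close> up to \<open>t\<close>, with \<open>x\<close> itself as the extension, compares
  the right difference quotient of \<open>\<omega>\<close> at \<open>t\<close> with \<open>a t\<close> plus the inner product of \<open>p t\<close> with the mean of
  \<open>l\<close> over \<open>[t, \<tau>]\<close>. The indefinite integral of \<open>a + p \<bullet> l\<close> satisfies the same comparison at every
  \<open>t < T\<close>, because \<open>a\<close> and \<open>p\<close> are continuous and \<open>l\<close> is bounded. Hence the difference of the two
  functions is continuous with right derivative zero at every point, and so it is constant
  (\<open>zero_right_derivative_imp_eq\<close>, \<open>eq_integral_rate\<close>). On \<open>[0, \<theta>]\<close> with \<open>\<theta> < T\<close> the integrand is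
  bounded, which gives the Lipschitz property, and Lebesgue's differentiation theorem gives the
  derivative almost everywhere.

  Continuity of motions, which the metric of positions relies on, comes from the weakly singular Volterra
  operator: it maps an essentially bounded function to a uniform limit of its images under operators with
  continuous kernels (\<open>continuous_on_volterra\<close>).\<close>

section \<open>One-sided derivatives and differentiation of integrals\<close>

text \<open>Only a one-sided derivative is assumed, at every point of the half-open interval; continuity
  excludes jumps from the left.\<close>

lemma zero_right_derivative_imp_eq:
  fixes f :: "real \<Rightarrow> real"
  assumes ab: "a \<le> b" and cont: "continuous_on {a..b} f"
    and deriv: "\<And>t. t \<in> {a..<b} \<Longrightarrow> ((\<lambda>\<tau>. (f \<tau> - f t) / (\<tau> - t)) \<longlongrightarrow> 0) (at_right t)"
  shows "f b = f a"
proof -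
  have bound: "\<bar>f b - f a\<bar> \<le> e * (b - a)" if e: "e > 0" for e
  proof (rule ccontr)
    assume not_le: "\<not> \<bar>f b - f a\<bar> \<le> e * (b - a)"
    \<comment> \<open>The last point \<open>m\<close> at which \<open>h \<le> 0\<close> is not \<open>b\<close>, and the vanishing
      right derivative at \<open>m\<close> produces a later such point.\<close>
    define h where "h t = \<bar>f t - f a\<bar> - e * (t - a)" for t
    define S where "S = {t \<in> {a..b}. h t \<in> {..0}}"
    have "continuous_on {a..b} h"
      unfolding h_def by (intro continuous_intros cont)
    then have "closed S"
      unfolding S_def using continuous_closed_preimage[of "{a..b}" h "{..0}"]
      by (simp add: vimage_def Int_def)
    moreover have "bounded S"
      by (rule bounded_subset[of "{a..b}"]) (auto simp: S_def)
    ultimately have "compact S"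
      by (simp add: compact_eq_bounded_closed)
    moreover have "a \<in> S"
      using ab by (simp add: S_def h_def)
    ultimately obtain m where m: "m \<in> S" and max: "\<And>t. t \<in> S \<Longrightarrow> t \<le> m"
      using compact_attains_sup[of S] by auto
    have "b \<notin> S"
      using not_le by (simp add: S_def h_def)
    with m have mb: "m \<in> {a..<b}"
      by (cases "m = b") (auto simp: S_def)
    have "eventually (\<lambda>\<tau>. \<bar>(f \<tau> - f m) / (\<tau> - m)\<bar> < e) (at_right m)"
      using tendstoD[OF deriv[OF mb] e] by (simp add: dist_real_def)
    moreover have "eventually (\<lambda>\<tau>. \<tau> \<in> {m<..<b}) (at_right m)"
      using mb by (intro eventually_at_right_real) auto
    ultimately have "eventually (\<lambda>\<tau>. \<bar>(f \<tau> - f m) / (\<tau> - m)\<bar> < e \<and> \<tau> \<in> {m<..<b}) (at_right m)"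
      by (rule eventually_conj)
    then obtain \<tau> where \<tau>: "\<bar>(f \<tau> - f m) / (\<tau> - m)\<bar> < e" "\<tau> \<in> {m<..<b}"
      using eventually_happens'[OF trivial_limit_at_right_real] by blast
    then have "\<bar>f \<tau> - f m\<bar> \<le> e * (\<tau> - m)"
      by (simp add: abs_divide divide_simps)
    moreover have "\<bar>f m - f a\<bar> \<le> e * (m - a)"
      using m by (simp add: S_def h_def)
    ultimately have "\<tau> \<in> S"
      using \<tau>(2) mb by (auto simp: S_def h_def algebra_simps)
    with max \<tau>(2) show False by force
  qed
  have "\<bar>f b - f a\<bar> \<le> 0 + e" if "e > 0" for e
  proof -
    have "e / (b - a + 1) > 0" using that ab by simp
    from bound[OF this] have "\<bar>f b - f a\<bar> \<le> e * ((b - a) / (b - a + 1))" by simp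
    also have "\<dots> \<le> e * 1"
      using that ab by (intro mult_left_mono) auto
    finally show ?thesis by simp
  qed
  then have "\<bar>f b - f a\<bar> \<le> 0"
    by (rule field_le_epsilon)
  then show ?thesis by simp
qed

text \<open>Lebesgue's differentiation theorem in dimension one, with a two-sided derivative.\<close>

lemma indefinite_integral_has_real_derivative_ae:
  fixes g :: "real \<Rightarrow> real"
  assumes g: "g integrable_on {a..b}"
  obtains N where "negligible N"
    "\<And>t. t \<in> {a<..<b} - N \<Longrightarrow> ((\<lambda>\<tau>. integral {a..\<tau>} g) has_real_derivative g t) (at t)"
proof -
  \<comment> \<open>The averages over \<open>[s, s + h]\<close> converge for almost every \<open>s\<close>; applied to the reflected
      function as well, this covers both sides.\<close>
  define g0 where "g0 s = (if s \<in> {a..b} then g s else 0)" for s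
  have g0_UNIV: "g0 integrable_on UNIV"
    unfolding g0_def using g by (simp only: integrable_restrict_UNIV)
  have g0_int: "g0 integrable_on {u..v}" for u v
    using integrable_on_subcbox[OF g0_UNIV, of u v] by simp
  have "(\<lambda>s. g0 (- s)) integrable_on {u..v}" for u v
    using g0_int[of "-v" "-u"] Henstock_Kurzweil_Integration.integrable_reflect_real[where f = g0 and a = "- v" and b = "- u"] by simp
  then obtain N2 where N2: "negligible N2"
      "\<And>s e. \<lbrakk>s \<notin> N2; 0 < e\<rbrakk> \<Longrightarrow> \<exists>d>0. \<forall>h. 0 < h \<and> h < d \<longrightarrow>
         \<bar>integral {s..s + h} (\<lambda>s. g0 (- s)) / h - g0 (- s)\<bar> < e"
    using integrable_ccontinuous_explicit[of "\<lambda>s. g0 (- s)"] 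
    by (simp add: divide_inverse mult.commute) metis
  obtain N1 where N1: "negligible N1"
      "\<And>s e. \<lbrakk>s \<notin> N1; 0 < e\<rbrakk> \<Longrightarrow> \<exists>d>0. \<forall>h. 0 < h \<and> h < d \<longrightarrow>
         \<bar>integral {s..s + h} g0 / h - g0 s\<bar> < e"
    using integrable_ccontinuous_explicit[of g0] g0_int
    by (simp add: divide_inverse mult.commute) metis
  have "negligible (uminus ` N2)"
    using N2(1) by (intro negligible_differentiable_image_negligible) (auto intro!: derivative_intros)
  with N1(1) have neg: "negligible (N1 \<union> uminus ` N2)"
    by (rule negligible_Un)
  have "((\<lambda>\<tau>. integral {a..\<tau>} g) has_real_derivative g t) (at t)"
    if t: "t \<in> {a<..<b} - (N1 \<union> uminus ` N2)" for t
  proof -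
    have tab: "a < t" "t < b" and tN: "t \<notin> N1" "- t \<notin> N2"
      using t by (auto simp: image_iff)
    have gt: "g0 t = g t" using tab by (simp add: g0_def)
    have F: "integral {a..\<tau>} g = integral {a..\<tau>} g0" if "\<tau> \<le> b" for \<tau>
      using that by (intro integral_cong) (auto simp: g0_def)
    have diff: "integral {a..v} g - integral {a..u} g = integral {u..v} g0"
      if "a \<le> u" "u \<le> v" "v \<le> b" for u v
      using that Henstock_Kurzweil_Integration.integral_combine[of a u v g0] g0_int by (simp add: F)
    show ?thesis
      unfolding DERIV_def
    proof (rule LIM_I)
      fix e :: real assume e: "0 < e"
      obtain d1 where d1: "d1 > 0" "\<And>h. 0 < h \<Longrightarrow> h < d1 \<Longrightarrow> \<bar>integral {t..t + h} g0 / h - g t\<bar> < e"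
        using N1(2)[OF tN(1) e] gt by auto
      obtain d2 where d2: "d2 > 0"
          "\<And>h. 0 < h \<Longrightarrow> h < d2 \<Longrightarrow> \<bar>integral {- t..- t + h} (\<lambda>s. g0 (- s)) / h - g t\<bar> < e"
        using N2(2)[OF tN(2) e] gt by auto
      define d where "d = min (min d1 d2) (min (b - t) (t - a))"
      have "norm ((integral {a..t + h} g - integral {a..t} g) / h - g t) < e"
        if "h \<noteq> 0" "norm h < d" for h
      proof (cases "h > 0")
        case True
        then have "integral {a..t + h} g - integral {a..t} g = integral {t..t + h} g0"
          using that tab by (intro diff) (auto simp: d_def)
        with d1(2)[of h] True that show ?thesis by (simp add: d_def)
      next
        case False
        with that have h: "h < 0" by simp
        then have "integral {a..t} g - integral {a..t + h} g = integral {t + h..t} g0"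
          using that tab by (intro diff) (auto simp: d_def)
        also have "\<dots> = integral {- t..- t + (- h)} (\<lambda>s. g0 (- s))"
          using Henstock_Kurzweil_Integration.integral_reflect_real[where f = g0 and a = "t + h" and b = t] by (simp add: add.commute)
        finally have "(integral {a..t + h} g - integral {a..t} g) / h
            = integral {- t..- t + (- h)} (\<lambda>s. g0 (- s)) / (- h)"
          using h by (simp add: field_simps)
        with d2(2)[of "- h"] h that show ?thesis by (simp add: d_def)
      qed
      moreover have "d > 0" using d1 d2 tab by (simp add: d_def)
      ultimately show "\<exists>s>0. \<forall>h. h \<noteq> 0 \<and> norm (h - 0) < s \<longrightarrow>
          norm ((integral {a..t + h} g - integral {a..t} g) / h - g t) < e"
        by auto
    qed
  qed
  with neg show ?thesis by (rule that)
qed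

section \<open>Weakly singular Volterra operators\<close>

lemma bounded_bilinear_matrix_vector_mult:
  "bounded_bilinear ((*v) :: real ^ 'n ^ 'm \<Rightarrow> real ^ 'n \<Rightarrow> real ^ 'm)"
  unfolding bilinear_conv_bounded_bilinear[symmetric] bilinear_def
  by (auto intro!: linearI simp: matrix_vector_mult_add_rdistrib matrix_vector_mult_scaleR
      matrix_vector_right_distrib scaleR_matrix_vector_assoc)

lemma borel_measurable_matrix_vector_mult [measurable (raw)]:
  fixes A :: "'a \<Rightarrow> real ^ 'n ^ 'm" and l :: "'a \<Rightarrow> real ^ 'n"
  assumes "A \<in> borel_measurable M" "l \<in> borel_measurable M"
  shows "(\<lambda>\<xi>. A \<xi> *v l \<xi>) \<in> borel_measurable M"
  using assms
  by (rule borel_measurable_continuous_Pair)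
     (intro bounded_bilinear.continuous_on[OF bounded_bilinear_matrix_vector_mult] continuous_intros)

lemma has_integral_abel_kernel:
  fixes \<gamma> \<tau> :: real
  assumes "0 < \<gamma>" "0 \<le> \<tau>"
  shows "((\<lambda>\<xi>. (\<tau> - \<xi>) powr (\<gamma> - 1)) has_integral \<tau> powr \<gamma> / \<gamma>) {0..\<tau>}"
proof -
  have "((\<lambda>\<xi>. (\<tau> - \<xi>) powr (\<gamma> - 1)) has_integral
      (- ((\<tau> - \<tau>) powr \<gamma> / \<gamma>) - - ((\<tau> - 0) powr \<gamma> / \<gamma>))) {0..\<tau>}"
  proof (rule fundamental_theorem_of_calculus_interior
      [where f = "\<lambda>\<xi>. - ((\<tau> - \<xi>) powr \<gamma> / \<gamma>)"])
    show "continuous_on {0..\<tau>} (\<lambda>\<xi>. - ((\<tau> - \<xi>) powr \<gamma> / \<gamma>))"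
      using assms by (intro continuous_intros continuous_on_powr') auto
    show "((\<lambda>\<xi>. - ((\<tau> - \<xi>) powr \<gamma> / \<gamma>)) has_vector_derivative (\<tau> - \<xi>) powr (\<gamma> - 1)) (at \<xi>)"
      if "\<xi> \<in> {0<..<\<tau>}" for \<xi>
      unfolding has_real_derivative_iff_has_vector_derivative[symmetric]
      using that assms by (auto intro!: derivative_eq_intros simp: field_simps)
  qed (use assms in auto)
  then show ?thesis using assms by simp
qed

text \<open>For a continuous kernel on a square the integral operator maps bounded measurable functions to
  continuous ones, by dominated convergence.\<close>

lemma continuous_on_integral_continuous_kernel:
  fixes G :: "real \<times> real \<Rightarrow> real ^ 'n ^ 'm" and l :: "real \<Rightarrow> real ^ 'n"
  assumes G: "continuous_on ({0..a} \<times> {0..a}) G"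
    and l: "l \<in> borel_measurable (lebesgue_on {0..a})" "\<And>\<xi>. norm (l \<xi>) \<le> C"
  shows "continuous_on {0..a} (\<lambda>\<tau>. integral {0..a} (\<lambda>\<xi>. G (\<tau>, \<xi>) *v l \<xi>))"
    and "\<tau> \<in> {0..a} \<Longrightarrow> (\<lambda>\<xi>. G (\<tau>, \<xi>) *v l \<xi>) integrable_on {0..a}"
proof -
  obtain B where B: "\<And>(A :: real ^ 'n ^ 'm) v. norm (A *v v) \<le> norm A * norm v * B" "B > 0"
    using bounded_bilinear.pos_bounded[OF bounded_bilinear_matrix_vector_mult] by blast
  have "compact (G ` ({0..a} \<times> {0..a}))"
    by (intro compact_continuous_image G compact_Times) auto
  then obtain M where M: "M > 0" "\<And>z. z \<in> {0..a} \<times> {0..a} \<Longrightarrow> norm (G z) \<le> M"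
    using compact_imp_bounded bounded_pos by (metis imageI)
  have C: "C \<ge> 0" using l(2) norm_ge_zero order_trans by blast
  have bound: "norm (G (\<tau>, \<xi>) *v l \<xi>) \<le> M * C * B" if "\<tau> \<in> {0..a}" "\<xi> \<in> {0..a}" for \<tau> \<xi>
  proof -
    have "norm (G (\<tau>, \<xi>) *v l \<xi>) \<le> norm (G (\<tau>, \<xi>)) * norm (l \<xi>) * B" by (rule B)
    also have "\<dots> \<le> M * C * B"
      using M that l(2) B(2) C by (intro mult_mono) auto
    finally show ?thesis .
  qed
  have int: "(\<lambda>\<xi>. G (\<tau>, \<xi>) *v l \<xi>) integrable_on {0..a}" if \<tau>: "\<tau> \<in> {0..a}" for \<tau>
  proof (rule measurable_bounded_by_integrable_imp_integrable)
    have "continuous_on {0..a} (\<lambda>\<xi>. G (\<tau>, \<xi>))"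
      using \<tau> by (intro continuous_on_compose2[OF G] continuous_intros) auto
    then have "(\<lambda>\<xi>. G (\<tau>, \<xi>)) \<in> borel_measurable (lebesgue_on {0..a})"
      by (intro continuous_imp_measurable_on_sets_lebesgue) auto
    with l(1) show "(\<lambda>\<xi>. G (\<tau>, \<xi>) *v l \<xi>) \<in> borel_measurable (lebesgue_on {0..a})"
      by measurable
    show "(\<lambda>_. M * C * B) integrable_on {0..a}" by (rule integrable_const_ivl)
    show "norm (G (\<tau>, \<xi>) *v l \<xi>) \<le> M * C * B" if "\<xi> \<in> {0..a}" for \<xi>
      using bound \<tau> that by blast
  qed auto
  then show "\<tau> \<in> {0..a} \<Longrightarrow> (\<lambda>\<xi>. G (\<tau>, \<xi>) *v l \<xi>) integrable_on {0..a}" .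
  show "continuous_on {0..a} (\<lambda>\<tau>. integral {0..a} (\<lambda>\<xi>. G (\<tau>, \<xi>) *v l \<xi>))"
    unfolding continuous_on_sequentially comp_def
  proof (intro allI ballI impI, elim conjE)
    fix s \<tau> assume \<tau>: "\<tau> \<in> {0..a}" and s: "\<forall>n. s n \<in> {0..a}" "s \<longlonglongrightarrow> \<tau>"
    show "(\<lambda>n. integral {0..a} (\<lambda>\<xi>. G (s n, \<xi>) *v l \<xi>)) \<longlonglongrightarrow> integral {0..a} (\<lambda>\<xi>. G (\<tau>, \<xi>) *v l \<xi>)"
    proof (rule Equivalence_Lebesgue_Henstock_Integration.dominated_convergence(2))
      show "(\<lambda>_. M * C * B) integrable_on {0..a}" by (rule integrable_const_ivl)
      show "(\<lambda>\<xi>. G (s n, \<xi>) *v l \<xi>) integrable_on {0..a}" for n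
        using int s by blast
      show "norm (G (s n, \<xi>) *v l \<xi>) \<le> M * C * B" if "\<xi> \<in> {0..a}" for n \<xi>
        using bound s that by blast
      show "(\<lambda>n. G (s n, \<xi>) *v l \<xi>) \<longlonglongrightarrow> G (\<tau>, \<xi>) *v l \<xi>" if \<xi>: "\<xi> \<in> {0..a}" for \<xi>
      proof -
        have "continuous_on {0..a} (\<lambda>\<tau>. G (\<tau>, \<xi>))"
          using \<xi> by (intro continuous_on_compose2[OF G] continuous_intros) auto
        then have "(\<lambda>n. G (s n, \<xi>)) \<longlonglongrightarrow> G (\<tau>, \<xi>)"
          using continuous_on_sequentially[of "{0..a}" "\<lambda>\<tau>. G (\<tau>, \<xi>)"] \<tau> s
          by (auto simp: comp_def)
        then show ?thesis
          by (rule bounded_bilinear.tendsto[OF bounded_bilinear_matrix_vector_mult]) simp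
      qed
    qed
  qed
qed

text \<open>An essentially bounded function agrees off a null set with a measurable one that is bounded
  everywhere, so pointwise estimates under the integral become available.\<close>

lemma Linf_bounded_representative:
  assumes l: "l \<in> Linf t"
  obtains l' N C where "l' \<in> borel_measurable (lebesgue_on {0..t})" "\<And>\<xi>. norm (l' \<xi>) \<le> C"
    "C \<ge> 0" "negligible N" "\<And>\<xi>. \<xi> \<in> {0..t} - N \<Longrightarrow> l' \<xi> = l \<xi>"
proof -
  obtain C where lm: "l \<in> borel_measurable (lebesgue_on {0..t})"
      and "AE \<xi> in lebesgue_on {0..t}. norm (l \<xi>) \<le> C"
    using l by (auto simp: Linf_def)
  then have "AE \<xi> in lebesgue. \<xi> \<in> {0..t} \<longrightarrow> norm (l \<xi>) \<le> C"
    by (simp add: AE_restrict_space_iff)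
  then obtain N where N: "N \<in> null_sets lebesgue"
      "\<And>\<xi>. \<xi> \<in> {0..t} - N \<Longrightarrow> norm (l \<xi>) \<le> C"
    by (auto elim!: AE_E3)
  define l' where "l' \<xi> = (if norm (l \<xi>) \<le> \<bar>C\<bar> then l \<xi> else 0)" for \<xi>
  show ?thesis
  proof
    show "l' \<in> borel_measurable (lebesgue_on {0..t})"
      unfolding l'_def using lm by measurable
    show "negligible N" using N by (simp add: negligible_iff_null_sets)
    show "l' \<xi> = l \<xi>" if "\<xi> \<in> {0..t} - N" for \<xi>
      using that N(2) by (force simp: l'_def)
  qed (auto simp: l'_def)
qed

text \<open>The kernel \<open>K\<close> is a continuous matrix function \<open>Kst\<close> times the Abel factor
  \<open>(\<tau> - \<xi>) powr (\<alpha> - 1)\<close>, and arbitrary on the diagonal.\<close>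

locale weakly_singular_kernel =
  fixes T \<alpha> :: real and K Kst :: "real \<times> real \<Rightarrow> real ^ 'n ^ 'n"
  assumes alpha_pos: "0 < \<alpha>" and alpha_less: "\<alpha> < 1"
    and Kst_cont: "continuous_on (Omega T) Kst"
    and K_eq: "\<And>\<tau> \<xi>. (\<tau>, \<xi>) \<in> Omega_open T \<Longrightarrow>
         K (\<tau>, \<xi>) = (1 / (\<tau> - \<xi>) powr (1 - \<alpha>)) *\<^sub>R Kst (\<tau>, \<xi>)"
begin

text \<open>The kernel with the value on the diagonal fixed to zero (as \<open>0 powr a = 0\<close>), where
  \<open>K\<close> itself is unspecified.\<close>

definition K0 :: "real \<times> real \<Rightarrow> real ^ 'n ^ 'n" where
  "K0 = (\<lambda>(\<tau>, \<xi>). (\<tau> - \<xi>) powr (\<alpha> - 1) *\<^sub>R Kst (\<tau>, \<xi>))"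

lemma K_eq_K0: "0 \<le> \<xi> \<Longrightarrow> \<xi> < \<tau> \<Longrightarrow> \<tau> \<le> T \<Longrightarrow> K (\<tau>, \<xi>) = K0 (\<tau>, \<xi>)"
  using K_eq[of \<tau> \<xi>] powr_minus_divide[of "\<tau> - \<xi>" "1 - \<alpha>"]
  by (simp add: Omega_open_def Omega_def K0_def)

lemma compact_Omega: "compact (Omega T)"
proof -
  have "Omega T = ({0..T} \<times> {0..T}) \<inter> {z. snd z \<le> fst z}"
    by (auto simp: Omega_def)
  moreover have "closed {z :: real \<times> real. snd z \<le> fst z}"
    by (intro closed_Collect_le continuous_intros)
  ultimately show ?thesis
    by (simp add: compact_Int_closed compact_Times)
qed

lemma Kst_apply_bound:
  obtains M where "M > 0"
    "\<And>\<tau> \<xi> v. 0 \<le> \<xi> \<Longrightarrow> \<xi> \<le> \<tau> \<Longrightarrow> \<tau> \<le> T \<Longrightarrow> norm (Kst (\<tau>, \<xi>) *v v) \<le> M * norm v"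
proof -
  obtain B where B: "\<And>(A :: real ^ 'n ^ 'n) v. norm (A *v v) \<le> norm A * norm v * B" "B > 0"
    using bounded_bilinear.pos_bounded[OF bounded_bilinear_matrix_vector_mult] by blast
  have "compact (Kst ` Omega T)"
    by (intro compact_continuous_image Kst_cont compact_Omega)
  then obtain M where M: "M > 0" "\<And>z. z \<in> Omega T \<Longrightarrow> norm (Kst z) \<le> M"
    using compact_imp_bounded bounded_pos by (metis imageI)
  have "norm (Kst (\<tau>, \<xi>) *v v) \<le> (M * B) * norm v" if "0 \<le> \<xi>" "\<xi> \<le> \<tau>" "\<tau> \<le> T" for \<tau> \<xi> v
  proof -
    have "norm (Kst (\<tau>, \<xi>) *v v) \<le> norm (Kst (\<tau>, \<xi>)) * norm v * B" by (rule B)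
    also have "\<dots> \<le> M * norm v * B"
      using M(2)[of "(\<tau>, \<xi>)"] that B(2) by (intro mult_right_mono) (auto simp: Omega_def)
    finally show ?thesis by (simp add: mult_ac)
  qed
  with M(1) B(2) show ?thesis by (intro that[of "M * B"]) auto
qed

lemma K0_integrable:
  assumes l: "l \<in> borel_measurable (lebesgue_on {0..t})" "\<And>\<xi>. norm (l \<xi>) \<le> C"
    and \<tau>: "0 \<le> \<tau>" "\<tau> \<le> t" and t: "t \<le> T"
  shows "(\<lambda>\<xi>. K0 (\<tau>, \<xi>) *v l \<xi>) absolutely_integrable_on {0..\<tau>}"
proof -
  obtain M where M: "M > 0"
      "\<And>\<tau> \<xi> v. 0 \<le> \<xi> \<Longrightarrow> \<xi> \<le> \<tau> \<Longrightarrow> \<tau> \<le> T \<Longrightarrow> norm (Kst (\<tau>, \<xi>) *v v) \<le> M * norm v"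
    by (rule Kst_apply_bound) auto
  show ?thesis
  proof (rule measurable_bounded_by_integrable_imp_absolutely_integrable)
    have "continuous_on {0..\<tau>} (\<lambda>\<xi>. Kst (\<tau>, \<xi>))"
      using \<tau> t by (intro continuous_on_compose2[OF Kst_cont] continuous_intros) (auto simp: Omega_def)
    then have Kst_meas: "(\<lambda>\<xi>. Kst (\<tau>, \<xi>)) \<in> borel_measurable (lebesgue_on {0..\<tau>})"
      by (intro continuous_imp_measurable_on_sets_lebesgue) auto
    have "continuous_on {0..\<tau>} (\<lambda>\<xi>. \<tau> - \<xi>)" by (intro continuous_intros)
    then have "(\<lambda>\<xi>. \<tau> - \<xi>) \<in> borel_measurable (lebesgue_on {0..\<tau>})"
      by (intro continuous_imp_measurable_on_sets_lebesgue) auto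
    then have "(\<lambda>\<xi>. (\<tau> - \<xi>) powr (\<alpha> - 1)) \<in> borel_measurable (lebesgue_on {0..\<tau>})"
      by measurable
    moreover have "l \<in> borel_measurable (lebesgue_on {0..\<tau>})"
      by (rule measurable_restrict_mono[OF l(1)]) (use \<tau> in auto)
    ultimately show "(\<lambda>\<xi>. K0 (\<tau>, \<xi>) *v l \<xi>) \<in> borel_measurable (lebesgue_on {0..\<tau>})"
      using Kst_meas unfolding K0_def by simp
    show "(\<lambda>\<xi>. (\<tau> - \<xi>) powr (\<alpha> - 1) * (M * C)) integrable_on {0..\<tau>}"
      using has_integral_abel_kernel[OF alpha_pos \<tau>(1)] by (intro integrable_on_mult_left) blast
    show "norm (K0 (\<tau>, \<xi>) *v l \<xi>) \<le> (\<tau> - \<xi>) powr (\<alpha> - 1) * (M * C)" if \<xi>: "\<xi> \<in> {0..\<tau>}" for \<xi>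
    proof -
      have "norm (Kst (\<tau>, \<xi>) *v l \<xi>) \<le> M * norm (l \<xi>)" using \<xi> \<tau> t by (intro M) auto
      also have "\<dots> \<le> M * C" using M(1) l(2) by (intro mult_left_mono) auto
      finally show ?thesis
        by (simp add: K0_def scaleR_matrix_vector_assoc[symmetric] mult_left_mono)
    qed
  qed auto
qed

lemma volterra_integrable:
  assumes l: "l \<in> Linf t" and \<tau>: "0 \<le> \<tau>" "\<tau> \<le> t" and t: "t \<le> T"
  shows "integrable (lebesgue_on {0..\<tau>}) (\<lambda>\<xi>. K (\<tau>, \<xi>) *v l \<xi>)"
proof -
  obtain l' N C where l': "l' \<in> borel_measurable (lebesgue_on {0..t})" "\<And>\<xi>. norm (l' \<xi>) \<le> C"
      and N: "negligible N" "\<And>\<xi>. \<xi> \<in> {0..t} - N \<Longrightarrow> l' \<xi> = l \<xi>"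
    using Linf_bounded_representative[OF l] by metis
  have "(\<lambda>\<xi>. K (\<tau>, \<xi>) *v l \<xi>) absolutely_integrable_on {0..\<tau>}"
  proof (rule absolutely_integrable_spike)
    show "(\<lambda>\<xi>. K0 (\<tau>, \<xi>) *v l' \<xi>) absolutely_integrable_on {0..\<tau>}"
      using l' \<tau> t by (rule K0_integrable)
    show "negligible (insert \<tau> N)" using N by simp
    show "K (\<tau>, \<xi>) *v l \<xi> = K0 (\<tau>, \<xi>) *v l' \<xi>" if "\<xi> \<in> {0..\<tau>} - insert \<tau> N" for \<xi>
      using that N(2)[of \<xi>] \<tau> t by (simp add: K_eq_K0)
  qed
  then show ?thesis by (rule absolutely_integrable_imp_integrable) auto
qed

text \<open>The factor \<open>max s 0 * max s \<delta> powr (\<alpha> - 2)\<close> is continuous on the whole line, vanishes for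
  \<open>s \<le> 0\<close> and equals \<open>s powr (\<alpha> - 1)\<close> for \<open>s \<ge> \<delta>\<close>. Half of the exponent \<open>\<alpha>\<close> is given up
  so that the error is an integrable power times a quantity that tends to zero with \<open>\<delta>\<close>.\<close>

lemma regularised_power_diff:
  assumes s: "s \<ge> 0" and \<delta>: "\<delta> > 0"
  shows "\<bar>s powr (\<alpha> - 1) - max s 0 * max s \<delta> powr (\<alpha> - 2)\<bar> \<le> \<delta> powr (\<alpha> / 2) * s powr (\<alpha> / 2 - 1)"
proof -
  consider "s = 0" | "s \<ge> \<delta>" | "0 < s" "s < \<delta>" using s by linarith
  then show ?thesis
  proof cases
    case 2
    then have "s * s powr (\<alpha> - 2) = s powr (\<alpha> - 1)"
      using \<delta> by (simp add: powr_mult_base)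
    with 2 s show ?thesis by (simp add: max_def)
  next
    case 3
    have "s * max s \<delta> powr (\<alpha> - 2) \<ge> 0" using s by simp
    moreover have "s * max s \<delta> powr (\<alpha> - 2) \<le> s powr (\<alpha> - 1)"
    proof (cases "\<alpha> \<le> 2")
      case True
      then have "s * max s \<delta> powr (\<alpha> - 2) \<le> s * s powr (\<alpha> - 2)"
        using 3 by (intro mult_left_mono powr_mono2') auto
      then show ?thesis using 3 by (simp add: powr_mult_base)
    qed (use alpha_less in simp)
    moreover have "s powr (\<alpha> - 1) = s powr (\<alpha> / 2) * s powr (\<alpha> / 2 - 1)"
      using 3 by (simp add: powr_add[symmetric])
    moreover have "s powr (\<alpha> / 2) * s powr (\<alpha> / 2 - 1) \<le> \<delta> powr (\<alpha> / 2) * s powr (\<alpha> / 2 - 1)"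
      using 3 alpha_pos by (intro mult_right_mono powr_mono2) auto
    moreover have "max s 0 = s" using s by simp
    ultimately have "0 \<le> s powr (\<alpha> - 1) - max s 0 * max s \<delta> powr (\<alpha> - 2)"
        "s powr (\<alpha> - 1) - max s 0 * max s \<delta> powr (\<alpha> - 2) \<le> \<delta> powr (\<alpha> / 2) * s powr (\<alpha> / 2 - 1)"
      by (simp_all only:)
    then show ?thesis by linarith
  qed (use \<delta> in simp)
qed

text \<open>The operators with the regularised kernels yield continuous functions, and they converge
  uniformly because of the preceding estimate.\<close>

lemma continuous_on_volterra:
  assumes l: "l \<in> Linf t" and t: "t \<le> T"
  shows "continuous_on {0..t} (volterra K l)"
proof -
  obtain l' N C where l': "l' \<in> borel_measurable (lebesgue_on {0..t})" "\<And>\<xi>. norm (l' \<xi>) \<le> C" "C \<ge> 0"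
      and N: "negligible N" "\<And>\<xi>. \<xi> \<in> {0..t} - N \<Longrightarrow> l' \<xi> = l \<xi>"
    using Linf_bounded_representative[OF l] by metis
  obtain M where M: "M > 0"
      "\<And>\<tau> \<xi> v. 0 \<le> \<xi> \<Longrightarrow> \<xi> \<le> \<tau> \<Longrightarrow> \<tau> \<le> T \<Longrightarrow> norm (Kst (\<tau>, \<xi>) *v v) \<le> M * norm v"
    by (rule Kst_apply_bound) auto
  define \<delta> where "\<delta> n = 1 / real (Suc n)" for n
  have \<delta>: "\<delta> n > 0" for n by (simp add: \<delta>_def)
  \<comment> \<open>The argument \<open>max \<tau> \<xi>\<close> extends \<open>Kst\<close> continuously from the triangle to the square; the scalar
      factor vanishes where the extension differs.\<close>
  define G where "G n = (\<lambda>(\<tau>, \<xi>). (max (\<tau> - \<xi>) 0 * max (\<tau> - \<xi>) (\<delta> n) powr (\<alpha> - 2)) *\<^sub>R Kst (max \<tau> \<xi>, \<xi>))"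
    for n
  define V where "V n \<tau> = integral {0..t} (\<lambda>\<xi>. G n (\<tau>, \<xi>) *v l' \<xi>)" for n \<tau>
  have G: "continuous_on ({0..t} \<times> {0..t}) (G n)" for n
  proof -
    have "continuous_on ({0..t} \<times> {0..t}) (\<lambda>z. Kst (max (fst z) (snd z), snd z))"
      by (intro continuous_on_compose2[OF Kst_cont] continuous_intros) (use t in \<open>auto simp: Omega_def\<close>)
    moreover have "max u (\<delta> n) \<noteq> 0" for u using \<delta>[of n] by linarith
    ultimately show ?thesis
      unfolding G_def case_prod_unfold by (intro continuous_intros) auto
  qed
  have V: "continuous_on {0..t} (V n)"
      and V_int: "\<tau> \<in> {0..t} \<Longrightarrow> (\<lambda>\<xi>. G n (\<tau>, \<xi>) *v l' \<xi>) integrable_on {0..t}" for n \<tau>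
    using continuous_on_integral_continuous_kernel[OF G l'(1,2)] unfolding V_def by auto
  have dist_le: "norm (V n \<tau> - volterra K l \<tau>) \<le> \<delta> n powr (\<alpha> / 2) * (t powr (\<alpha> / 2) / (\<alpha> / 2) * (M * C))"
    if \<tau>: "\<tau> \<in> {0..t}" for n \<tau>
  proof -
    have K0_int: "(\<lambda>\<xi>. K0 (\<tau>, \<xi>) *v l' \<xi>) integrable_on {0..\<tau>}"
      using K0_integrable[OF l'(1,2)] \<tau> t
      by (intro set_lebesgue_integral_eq_integral(1)) auto
    have "volterra K l \<tau> = integral {0..\<tau>} (\<lambda>\<xi>. K (\<tau>, \<xi>) *v l \<xi>)"
      unfolding volterra_def
      using volterra_integrable[OF l _ _ t] \<tau> by (intro lebesgue_integral_eq_integral) auto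
    also have "\<dots> = integral {0..\<tau>} (\<lambda>\<xi>. K0 (\<tau>, \<xi>) *v l' \<xi>)"
    proof (rule integral_spike)
      show "negligible (insert \<tau> N)" using N by simp
      show "K0 (\<tau>, \<xi>) *v l' \<xi> = K (\<tau>, \<xi>) *v l \<xi>" if "\<xi> \<in> {0..\<tau>} - insert \<tau> N" for \<xi>
        using that N(2)[of \<xi>] \<tau> t by (simp add: K_eq_K0)
    qed
    finally have vol: "volterra K l \<tau> = integral {0..\<tau>} (\<lambda>\<xi>. K0 (\<tau>, \<xi>) *v l' \<xi>)" .
    have G_int: "(\<lambda>\<xi>. G n (\<tau>, \<xi>) *v l' \<xi>) integrable_on {0..\<tau>}"
      by (rule integrable_on_subinterval[OF V_int[OF \<tau>]]) (use \<tau> in auto)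
    have G_zero: "G n (\<tau>, \<xi>) *v l' \<xi> = 0" if "\<tau> < \<xi>" for \<xi>
      using that by (simp add: G_def max_absorb2)
    have "V n \<tau> = integral {0..\<tau>} (\<lambda>\<xi>. G n (\<tau>, \<xi>) *v l' \<xi>)"
      unfolding V_def
      by (rule integral_spike_set; rule empty_imp_negligible) (use \<tau> G_zero in \<open>auto simp: not_le\<close>)
    then have "norm (V n \<tau> - volterra K l \<tau>)
        = norm (integral {0..\<tau>} (\<lambda>\<xi>. G n (\<tau>, \<xi>) *v l' \<xi> - K0 (\<tau>, \<xi>) *v l' \<xi>))"
      using G_int K0_int by (simp add: vol Henstock_Kurzweil_Integration.integral_diff)
    also have "\<dots> \<le> integral {0..\<tau>}
        (\<lambda>\<xi>. (\<tau> - \<xi>) powr (\<alpha> / 2 - 1) * (\<delta> n powr (\<alpha> / 2) * (M * C)))"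
    proof (rule Henstock_Kurzweil_Integration.integral_norm_bound_integral)
      show "(\<lambda>\<xi>. G n (\<tau>, \<xi>) *v l' \<xi> - K0 (\<tau>, \<xi>) *v l' \<xi>) integrable_on {0..\<tau>}"
        using G_int K0_int by (rule integrable_diff)
      show "(\<lambda>\<xi>. (\<tau> - \<xi>) powr (\<alpha> / 2 - 1) * (\<delta> n powr (\<alpha> / 2) * (M * C))) integrable_on {0..\<tau>}"
        using has_integral_abel_kernel[of "\<alpha> / 2" \<tau>] alpha_pos \<tau>
        by (intro integrable_on_mult_left) auto
      fix \<xi> assume \<xi>: "\<xi> \<in> {0..\<tau>}"
      let ?k = "max (\<tau> - \<xi>) 0 * max (\<tau> - \<xi>) (\<delta> n) powr (\<alpha> - 2)"
      have "G n (\<tau>, \<xi>) *v l' \<xi> - K0 (\<tau>, \<xi>) *v l' \<xi>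
          = (?k - (\<tau> - \<xi>) powr (\<alpha> - 1)) *\<^sub>R (Kst (\<tau>, \<xi>) *v l' \<xi>)"
        using \<xi> by (simp add: G_def K0_def max_absorb1 scaleR_matrix_vector_assoc[symmetric] scaleR_diff_left)
      then have "norm (G n (\<tau>, \<xi>) *v l' \<xi> - K0 (\<tau>, \<xi>) *v l' \<xi>)
          = \<bar>(\<tau> - \<xi>) powr (\<alpha> - 1) - ?k\<bar> * norm (Kst (\<tau>, \<xi>) *v l' \<xi>)"
        by (simp add: abs_minus_commute)
      also have "\<dots> \<le> (\<delta> n powr (\<alpha> / 2) * (\<tau> - \<xi>) powr (\<alpha> / 2 - 1)) * (M * C)"
      proof (rule mult_mono)
        show "\<bar>(\<tau> - \<xi>) powr (\<alpha> - 1) - ?k\<bar> \<le> \<delta> n powr (\<alpha> / 2) * (\<tau> - \<xi>) powr (\<alpha> / 2 - 1)"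
          using \<xi> \<delta> by (intro regularised_power_diff) auto
        have "norm (Kst (\<tau>, \<xi>) *v l' \<xi>) \<le> M * norm (l' \<xi>)"
          using \<xi> \<tau> t by (intro M) auto
        also have "\<dots> \<le> M * C" using M(1) l'(2) by (intro mult_left_mono) auto
        finally show "norm (Kst (\<tau>, \<xi>) *v l' \<xi>) \<le> M * C" .
      qed auto
      finally show "norm (G n (\<tau>, \<xi>) *v l' \<xi> - K0 (\<tau>, \<xi>) *v l' \<xi>)
          \<le> (\<tau> - \<xi>) powr (\<alpha> / 2 - 1) * (\<delta> n powr (\<alpha> / 2) * (M * C))"
        by (simp add: mult_ac)
    qed
    also have "\<dots> = \<tau> powr (\<alpha> / 2) / (\<alpha> / 2) * (\<delta> n powr (\<alpha> / 2) * (M * C))"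
      using has_integral_abel_kernel[of "\<alpha> / 2" \<tau>] alpha_pos \<tau>
      by (intro integral_unique has_integral_mult_left) auto
    also have "\<dots> \<le> t powr (\<alpha> / 2) / (\<alpha> / 2) * (\<delta> n powr (\<alpha> / 2) * (M * C))"
      using \<tau> alpha_pos M(1) l'(3)
      by (intro mult_right_mono divide_right_mono powr_mono2) auto
    finally show ?thesis by (simp add: mult_ac)
  qed
  have "(\<lambda>n. \<delta> n powr (\<alpha> / 2) * (t powr (\<alpha> / 2) / (\<alpha> / 2) * (M * C)))
      \<longlonglongrightarrow> 0 powr (\<alpha> / 2) * (t powr (\<alpha> / 2) / (\<alpha> / 2) * (M * C))"
  proof (intro tendsto_mult tendsto_const tendsto_powr')
    show "\<delta> \<longlonglongrightarrow> 0" unfolding \<delta>_def by (rule LIMSEQ_Suc) (rule lim_1_over_n)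
    show "0 \<noteq> (0::real) \<or> 0 < \<alpha> / 2 \<and> (\<forall>\<^sub>F n in sequentially. 0 \<le> \<delta> n)"
      using alpha_pos by (simp add: \<delta>_def)
  qed
  then have lim: "(\<lambda>n. \<delta> n powr (\<alpha> / 2) * (t powr (\<alpha> / 2) / (\<alpha> / 2) * (M * C))) \<longlonglongrightarrow> 0"
    by simp
  have "uniform_limit {0..t} V (volterra K l) sequentially"
  proof (rule uniform_limitI)
    fix e :: real assume "e > 0"
    from order_tendstoD(2)[OF lim this]
    show "\<forall>\<^sub>F n in sequentially. \<forall>\<tau>\<in>{0..t}. dist (V n \<tau>) (volterra K l \<tau>) < e"
      by (rule eventually_mono) (unfold dist_norm, blast intro: le_less_trans[OF dist_le])
  qed
  then show ?thesis
    by (rule uniform_limit_theorem[rotated]) (simp_all add: V)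
qed

end

section \<open>The metric space of positions\<close>

lemma Linf_mono:
  assumes l: "l \<in> Linf t" and st: "s \<le> t"
  shows "l \<in> Linf s"
proof -
  from l obtain C where "AE \<xi> in lebesgue_on {0..t}. norm (l \<xi>) \<le> C"
    by (auto simp: Linf_def)
  then have "AE \<xi> in lebesgue_on {0..s}. norm (l \<xi>) \<le> C"
    using st
    by (auto simp: AE_restrict_space_iff elim!: eventually_mono)
  moreover have "l \<in> borel_measurable (lebesgue_on {0..s})"
    by (rule measurable_restrict_mono[of _ _ "{0..t}"]) (use l st in \<open>auto simp: Linf_def\<close>)
  ultimately show ?thesis unfolding Linf_def by blast
qed

lemma Linf_diff:
  assumes "l \<in> Linf t" "l' \<in> Linf t"
  shows "(\<lambda>\<xi>. l \<xi> - l' \<xi>) \<in> Linf t"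
proof -
  from assms obtain C C' where "AE \<xi> in lebesgue_on {0..t}. norm (l \<xi>) \<le> C"
      "AE \<xi> in lebesgue_on {0..t}. norm (l' \<xi>) \<le> C'"
    by (auto simp: Linf_def)
  then have "AE \<xi> in lebesgue_on {0..t}. norm (l \<xi> - l' \<xi>) \<le> C + C'"
  proof eventually_elim
    case (elim \<xi>)
    then show ?case using norm_triangle_ineq4[of "l \<xi>" "l' \<xi>"] by linarith
  qed
  moreover have "(\<lambda>\<xi>. l \<xi> - l' \<xi>) \<in> borel_measurable (lebesgue_on {0..t})"
    using assms unfolding Linf_def by (intro borel_measurable_diff) blast+
  ultimately show ?thesis unfolding Linf_def by blast
qed

text \<open>The data that determine the positions: the kernel, the free term \<open>y\<close>, and injectivity of the
  Volterra operator on each initial interval.\<close>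

locale volterra_positions = weakly_singular_kernel T \<alpha> K Kst
  for T \<alpha> :: real and K Kst :: "real \<times> real \<Rightarrow> real ^ 'n ^ 'n" +
  fixes y :: "real \<Rightarrow> real ^ 'n"
  assumes T_pos: "T > 0"
    and y_cont: "continuous_on {0..T} y"
    and K_unique: "\<And>t l. 0 < t \<Longrightarrow> t \<le> T \<Longrightarrow> l \<in> Linf t \<Longrightarrow> (\<forall>\<tau>\<in>{0..t}. volterra K l \<tau> = 0) \<Longrightarrow>
         AE \<xi> in lebesgue_on {0..t}. l \<xi> = 0"
begin

lemma represents_continuous:
  assumes "represents y K t w l" "t \<le> T"
  shows "continuous_on {0..t} w"
proof -
  have "continuous_on {0..t} (\<lambda>\<tau>. y \<tau> + volterra K l \<tau>)"
    using assms by (intro continuous_intros continuous_on_volterra continuous_on_subset[OF y_cont])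
      (auto simp: represents_def)
  then show ?thesis
    by (rule continuous_on_eq) (use assms in \<open>auto simp: represents_def\<close>)
qed

lemma motion_continuous:
  assumes w: "w \<in> motions y K t" and t: "t \<le> T"
  shows "continuous_on {0..t} w"
proof (cases "t = 0")
  case False
  with w obtain l where "represents y K t w l" by (auto simp: motions_def)
  then show ?thesis using t by (rule represents_continuous)
qed simp

lemma position_path_continuous:
  assumes "z \<in> positions T y K"
  shows "continuous_on {0..T} (\<lambda>\<tau>. snd z (min \<tau> (fst z)))"
proof (rule continuous_on_compose2[where g = "snd z" and f = "\<lambda>\<tau>. min \<tau> (fst z)"])
  show "continuous_on {0..fst z} (snd z)"
    using assms by (intro motion_continuous) (auto simp: positions_def)
  show "continuous_on {0..T} (\<lambda>\<tau>. min \<tau> (fst z))" by (intro continuous_intros)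
  show "(\<lambda>\<tau>. min \<tau> (fst z)) ` {0..T} \<subseteq> {0..fst z}"
    using assms by (auto simp: positions_def)
qed

lemma bdd_above_position_dist:
  assumes "z \<in> positions T y K" "z' \<in> positions T y K"
  shows "bdd_above ((\<lambda>\<tau>. norm (snd z (min \<tau> (fst z)) - snd z' (min \<tau> (fst z')))) ` {0..T})"
proof -
  have "continuous_on {0..T} (\<lambda>\<tau>. norm (snd z (min \<tau> (fst z)) - snd z' (min \<tau> (fst z'))))"
    using assms by (intro continuous_on_norm continuous_on_diff position_path_continuous)
  then show ?thesis
    by (intro bounded_imp_bdd_above compact_imp_bounded compact_continuous_image) auto
qed

text \<open>Continuity of the positions makes the suprema finite, so that the upper bounds they satisfy
  can be used in each of the metric axioms.\<close>

lemma Metric_space_positions: "Metric_space (positions T y K) (pos_dist T y K)"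
proof -
  let ?P = "positions T y K"
  define D where "D z z' \<tau> = norm (snd z (min \<tau> (fst z)) - snd z' (min \<tau> (fst z')))"
    for z z' :: "real \<times> (real \<Rightarrow> real ^ 'n)" and \<tau>
  have dist_eq: "pos_dist T y K z z' = \<bar>fst z - fst z'\<bar> + (SUP \<tau>\<in>{0..T}. D z z' \<tau>)"
    if "z \<in> ?P" "z' \<in> ?P" for z z'
    using that by (simp add: pos_dist_def D_def)
  have upper: "D z z' \<tau> \<le> (SUP \<tau>\<in>{0..T}. D z z' \<tau>)" if "z \<in> ?P" "z' \<in> ?P" "\<tau> \<in> {0..T}" for z z' \<tau>
    using cSUP_upper[OF that(3) bdd_above_position_dist[OF that(1,2)]] by (simp add: D_def)
  have D_nonneg: "0 \<le> D z z' \<tau>" for z z' \<tau> by (simp add: D_def)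
  have sup_nonneg: "0 \<le> (SUP \<tau>\<in>{0..T}. D z z' \<tau>)" if "z \<in> ?P" "z' \<in> ?P" for z z'
    using upper[OF that, of 0] D_nonneg[of z z' 0] T_pos by simp
  show ?thesis
  proof
    fix z z' z'' :: "real \<times> (real \<Rightarrow> real ^ 'n)"
    show "0 \<le> pos_dist T y K z z'"
      using sup_nonneg[of z z'] dist_eq[of z z'] by (auto simp: pos_dist_def)
    show "pos_dist T y K z z' = pos_dist T y K z' z"
      by (simp add: pos_dist_def norm_minus_commute abs_minus_commute)
    show "pos_dist T y K z z'' \<le> pos_dist T y K z z' + pos_dist T y K z' z''"
      if z: "z \<in> ?P" "z' \<in> ?P" "z'' \<in> ?P"
    proof -
      have "(SUP \<tau>\<in>{0..T}. D z z'' \<tau>) \<le> (SUP \<tau>\<in>{0..T}. D z z' \<tau>) + (SUP \<tau>\<in>{0..T}. D z' z'' \<tau>)"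
      proof (rule cSUP_least)
        fix \<tau> assume \<tau>: "\<tau> \<in> {0..T}"
        have "D z z'' \<tau> \<le> D z z' \<tau> + D z' z'' \<tau>"
          unfolding D_def dist_norm[symmetric] by (rule dist_triangle)
        also have "\<dots> \<le> (SUP \<tau>\<in>{0..T}. D z z' \<tau>) + (SUP \<tau>\<in>{0..T}. D z' z'' \<tau>)"
          using z \<tau> by (intro add_mono upper)
        finally show "D z z'' \<tau> \<le> (SUP \<tau>\<in>{0..T}. D z z' \<tau>) + (SUP \<tau>\<in>{0..T}. D z' z'' \<tau>)" .
      qed (use T_pos in auto)
      with z show ?thesis by (simp add: dist_eq)
    qed
    show "pos_dist T y K z z' = 0 \<longleftrightarrow> z = z'" if z: "z \<in> ?P" "z' \<in> ?P"
    proof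
      assume "pos_dist T y K z z' = 0"
      then have 0: "fst z = fst z'" "(SUP \<tau>\<in>{0..T}. D z z' \<tau>) = 0"
        using sup_nonneg[OF z] by (auto simp: dist_eq[OF z])
      have ext: "snd z \<in> extensional {0..fst z}" "snd z' \<in> extensional {0..fst z}" "fst z \<le> T"
        using z 0(1) by (auto simp: positions_def motions_def)
      have "snd z \<tau> = snd z' \<tau>" if "\<tau> \<in> {0..fst z}" for \<tau>
        using upper[OF z, of \<tau>] 0 that ext(3) by (simp add: D_def)
      then have "snd z = snd z'" by (rule extensionalityI[OF ext(1,2)])
      with 0(1) show "z = z'" by (rule prod_eqI)
    next
      assume "z = z'"
      then show "pos_dist T y K z z' = 0"
        using T_pos by (simp add: pos_dist_def)
    qed
  qed
qed

lemma represents_ell: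
  assumes "w \<in> motions y K t" "t \<noteq> 0"
  shows "represents y K t w (ell y K t w)"
proof -
  obtain l where "represents y K t w l"
    using assms by (auto simp: motions_def)
  then have "represents y K t w (SOME l. represents y K t w l)" 
    by (rule someI[where P = "represents y K t w"])
  with assms(2) show ?thesis by (simp add: ell_def)
qed

lemma represents_restrict:
  assumes "represents y K T x l" "t \<le> T"
  shows "represents y K t (restrict x {0..t}) l"
  using assms Linf_mono[of l T t] by (auto simp: represents_def)

lemma represents_unique:
  assumes t: "0 < t" "t \<le> T" and l: "represents y K t w l" and l': "represents y K t w l'"
  shows "AE \<xi> in lebesgue_on {0..t}. l \<xi> = l' \<xi>"
proof -
  have Linf: "l \<in> Linf t" "l' \<in> Linf t" using l l' by (auto simp: represents_def)
  have "volterra K (\<lambda>\<xi>. l \<xi> - l' \<xi>) \<tau> = 0" if "\<tau> \<in> {0..t}" for \<tau>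
  proof -
    have "volterra K (\<lambda>\<xi>. l \<xi> - l' \<xi>) \<tau> = volterra K l \<tau> - volterra K l' \<tau>"
      unfolding volterra_def matrix_vector_mult_diff_distrib
      using that t Linf by (intro Bochner_Integration.integral_diff volterra_integrable) auto
    moreover have "w \<tau> = y \<tau> + volterra K l \<tau>" "w \<tau> = y \<tau> + volterra K l' \<tau>"
      using that l l' by (auto simp: represents_def)
    ultimately show ?thesis by simp
  qed
  from K_unique[OF t Linf_diff[OF Linf]] this show ?thesis by simp
qed

text \<open>At \<open>t = 0\<close> membership demands \<open>x 0 = y 0\<close>, which holds because the Volterra integral over a
  point vanishes.\<close>

lemma restrict_motion:
  assumes x: "x \<in> motions y K T" and t: "t \<in> {0..T}"
  shows "restrict x {0..t} \<in> motions y K t"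
proof -
  have rep: "represents y K T x (ell y K T x)"
    using x T_pos by (intro represents_ell) auto
  have "integrable (lebesgue_on {0..0}) (\<lambda>\<xi>. K (0, \<xi>) *v ell y K T x \<xi>)"
    using volterra_integrable[of "ell y K T x" T 0] rep T_pos by (simp add: represents_def)
  then have "volterra K (ell y K T x) 0 = 0"
    unfolding volterra_def by (subst lebesgue_integral_eq_integral) auto
  then have "x 0 = y 0"
    using rep T_pos by (simp add: represents_def)
  moreover have "represents y K t (restrict x {0..t}) (ell y K T x)"
    using rep t by (intro represents_restrict) auto
  ultimately show ?thesis by (auto simp: motions_def)
qed

lemma restrict_position:
  "x \<in> motions y K T \<Longrightarrow> t \<in> {0..T} \<Longrightarrow> (t, restrict x {0..t}) \<in> positions T y K"
  by (simp add: positions_def restrict_motion)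

text \<open>One index \<open>k\<close> serves all initial segments of a motion: by uniqueness the function generating
  the segment is the restriction of the one generating \<open>x\<close>, and the latter is essentially bounded.\<close>

lemma restrict_positions_k:
  assumes x: "x \<in> motions y K T" and c: "c > 0"
  obtains k where "\<And>t. t \<in> {0..T} \<Longrightarrow> (t, restrict x {0..t}) \<in> positions_k T y K c k"
proof -
  have rep: "represents y K T x (ell y K T x)"
    using x T_pos by (intro represents_ell) auto
  then obtain C where C: "AE \<xi> in lebesgue_on {0..T}. norm (ell y K T x \<xi>) \<le> C"
    by (auto simp: represents_def Linf_def)
  obtain k where "C / c \<le> real k" using real_arch_simple by blast
  with c have k: "C \<le> real k * c" by (simp add: divide_simps)
  have "(t, restrict x {0..t}) \<in> positions_k T y K c k" if t: "t \<in> {0..T}" for t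
  proof -
    have "AE \<xi> in lebesgue_on {0..t}.
        norm (ell y K t (restrict x {0..t}) \<xi>) \<le> real k * c * (1 + norm (restrict x {0..t} \<xi>))"
    proof (cases "t = 0")
      case True
      then show ?thesis using c by (simp add: ell_def)
    next
      case False
      have "AE \<xi> in lebesgue_on {0..t}. ell y K t (restrict x {0..t}) \<xi> = ell y K T x \<xi>"
        using t False rep x
        by (intro represents_unique[of t "restrict x {0..t}"] represents_ell represents_restrict restrict_motion) auto
      moreover have "AE \<xi> in lebesgue_on {0..t}. norm (ell y K T x \<xi>) \<le> C"
        using C t by (auto simp: AE_restrict_space_iff elim!: eventually_mono)
      ultimately show ?thesis
      proof eventually_elim
        case (elim \<xi>)
        have "C \<le> real k * c * 1" using k by simp
        also have "\<dots> \<le> real k * c * (1 + norm (restrict x {0..t} \<xi>))"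
          using c by (intro mult_left_mono) auto
        finally show ?case using elim by simp
      qed
    qed
    then show ?thesis using restrict_position[OF x t] by (simp add: positions_k_def)
  qed
  then show ?thesis by (rule that)
qed

lemma continuous_map_restrict_motion:
  assumes x: "x \<in> motions y K T"
  shows "continuous_map (top_of_set {0..T}) (pos_topology T y K) (\<lambda>t. (t, restrict x {0..t}))"
proof -
  interpret P: Metric_space "positions T y K" "pos_dist T y K"
    by (rule Metric_space_positions)
  have "uniformly_continuous_on {0..T} x"
    using motion_continuous[OF x] by (intro compact_uniformly_continuous) auto
  show ?thesis
    unfolding pos_topology_def P.continuous_map_to_metric
  proof (intro ballI allI impI)
    fix t \<epsilon> :: real assume t: "t \<in> topspace (top_of_set {0..T})" and \<epsilon>: "\<epsilon> > 0"
    obtain d where d: "d > 0"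
        "\<And>s s'. s \<in> {0..T} \<Longrightarrow> s' \<in> {0..T} \<Longrightarrow> dist s' s < d \<Longrightarrow> dist (x s') (x s) < \<epsilon> / 3"
      using \<open>uniformly_continuous_on {0..T} x\<close> \<epsilon> unfolding uniformly_continuous_on_def
      by (metis divide_pos_pos zero_less_numeral)
    let ?U = "{0..T} \<inter> ball t (min d (\<epsilon> / 3))"
    have "(s, restrict x {0..s}) \<in> P.mball (t, restrict x {0..t}) \<epsilon>" if s: "s \<in> ?U" for s
    proof -
      have "(SUP \<tau>\<in>{0..T}. norm (restrict x {0..t} (min \<tau> t) - restrict x {0..s} (min \<tau> s))) \<le> \<epsilon> / 3"
      proof (rule cSUP_least)
        fix \<tau> assume \<tau>: "\<tau> \<in> {0..T}"
        \<comment> \<open>Truncating the time argument at \<open>t\<close> or at \<open>s\<close> moves it by at most \<open>\<bar>t - s\<bar>\<close>.\<close>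
        have "\<bar>min \<tau> t - min \<tau> s\<bar> \<le> \<bar>t - s\<bar>" by (auto simp: min_def)
        then have "dist (x (min \<tau> t)) (x (min \<tau> s)) < \<epsilon> / 3"
          using \<tau> s t by (intro d(2)) (auto simp: dist_real_def)
        then show "norm (restrict x {0..t} (min \<tau> t) - restrict x {0..s} (min \<tau> s)) \<le> \<epsilon> / 3"
          using \<tau> s t by (simp add: dist_norm)
      qed (use T_pos in auto)
      moreover have "\<bar>t - s\<bar> < \<epsilon> / 3" using s by (simp add: dist_real_def)
      moreover have "(t, restrict x {0..t}) \<in> positions T y K" "(s, restrict x {0..s}) \<in> positions T y K"
        using restrict_position[OF x] s t by auto
      ultimately show ?thesis using \<epsilon> by (simp add: P.mball_def pos_dist_def)
    qed
    moreover have "openin (top_of_set {0..T}) ?U" by (intro openin_open_Int) simp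
    moreover have "t \<in> ?U" using t \<epsilon> d(1) by simp
    ultimately show "\<exists>U. openin (top_of_set {0..T}) U \<and> t \<in> U \<and>
        (\<forall>s\<in>U. (s, restrict x {0..s}) \<in> P.mball (t, restrict x {0..t}) \<epsilon>)"
      by blast
  qed
qed

text \<open>Functionals that are continuous on a set of positions containing the segments of a motion are
  continuous along that motion.\<close>

lemma continuous_on_along_motion:
  fixes f :: "real \<times> (real \<Rightarrow> real ^ 'n) \<Rightarrow> 'b :: topological_space"
  assumes x: "x \<in> motions y K T"
    and f: "continuous_map (subtopology (pos_topology T y K) Z) euclidean f"
    and S: "S \<subseteq> {0..T}" "\<And>t. t \<in> S \<Longrightarrow> (t, restrict x {0..t}) \<in> Z"
  shows "continuous_on S (\<lambda>t. f (t, restrict x {0..t}))"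
proof -
  have "continuous_map (top_of_set S) (pos_topology T y K) (\<lambda>t. (t, restrict x {0..t}))"
    using continuous_map_from_subtopology_mono[OF continuous_map_restrict_motion[OF x] S(1)] .
  then have "continuous_map (top_of_set S) (subtopology (pos_topology T y K) Z) (\<lambda>t. (t, restrict x {0..t}))"
    using S(2) by (intro continuous_map_into_subtopology) auto
  from continuous_map_compose[OF this f] show ?thesis
    by (simp add: comp_def)
qed

end

section \<open>Recovering a function from its right difference quotients\<close>

text \<open>A real-variable form of the chain rule along a motion. The functions \<open>a\<close> and \<open>p\<close> stand for the
  two coinvariant derivatives along the motion, and \<open>l\<close> for a bounded version of the function that
  generates it. The hypothesis concerns right difference quotients only, but holds at every point
  \<open>t < \<theta>\<close>.\<close>

locale nonanticipative_chain_rule =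
  fixes \<omega> a :: "real \<Rightarrow> real" and p l :: "real \<Rightarrow> 'a :: euclidean_space" and \<theta> C :: real
  assumes \<theta>: "0 \<le> \<theta>"
    and \<omega>_cont: "continuous_on {0..\<theta>} \<omega>"
    and a_cont: "continuous_on {0..\<theta>} a" and p_cont: "continuous_on {0..\<theta>} p"
    and l_meas: "l \<in> borel_measurable (lebesgue_on {0..\<theta>})" and l_bound: "\<And>\<xi>. norm (l \<xi>) \<le> C"
    and quotient: "\<And>t. t \<in> {0..<\<theta>} \<Longrightarrow>
      ((\<lambda>\<tau>. \<bar>(\<omega> \<tau> - \<omega> t) / (\<tau> - t) - a t - p t \<bullet> ((1 / (\<tau> - t)) *\<^sub>R integral {t..\<tau>} l)\<bar>)
        \<longlongrightarrow> 0) (at_right t)"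
begin

text \<open>The expected derivative of \<open>\<omega>\<close>.\<close>

definition rate :: "real \<Rightarrow> real" where
  "rate \<tau> = a \<tau> + p \<tau> \<bullet> l \<tau>"

lemma rate_bounded:
  obtains M where "\<And>\<tau>. \<tau> \<in> {0..\<theta>} \<Longrightarrow> \<bar>rate \<tau>\<bar> \<le> M"
proof -
  obtain A P where A: "\<And>\<tau>. \<tau> \<in> {0..\<theta>} \<Longrightarrow> norm (a \<tau>) \<le> A"
      and P: "\<And>\<tau>. \<tau> \<in> {0..\<theta>} \<Longrightarrow> norm (p \<tau>) \<le> P"
    using compact_imp_bounded[OF compact_continuous_image[OF a_cont]]
      compact_imp_bounded[OF compact_continuous_image[OF p_cont]]
    unfolding bounded_iff by (metis compact_Icc imageI)
  have "\<bar>rate \<tau>\<bar> \<le> A + P * C" if \<tau>: "\<tau> \<in> {0..\<theta>}" for \<tau>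
  proof -
    have "\<bar>p \<tau> \<bullet> l \<tau>\<bar> \<le> norm (p \<tau>) * norm (l \<tau>)" by (rule Cauchy_Schwarz_ineq2)
    also have "\<dots> \<le> P * C"
      using P[OF \<tau>] l_bound[of \<tau>] norm_ge_zero[of "p \<tau>"] order_trans[of 0 "norm (p \<tau>)" P]
      by (intro mult_mono) auto
    finally show ?thesis using A[OF \<tau>] by (simp add: rate_def)
  qed
  then show ?thesis by (rule that)
qed

lemma l_integrable: "0 \<le> u \<Longrightarrow> v \<le> \<theta> \<Longrightarrow> l integrable_on {u..v}"
proof (rule measurable_bounded_by_integrable_imp_integrable)
  assume "0 \<le> u" "v \<le> \<theta>"
  then show "l \<in> borel_measurable (lebesgue_on {u..v})"
    by (intro measurable_restrict_mono[OF l_meas]) auto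
  show "(\<lambda>_. C) integrable_on {u..v}" by (rule integrable_const_ivl)
qed (use l_bound in auto)

lemma rate_integrable: "0 \<le> u \<Longrightarrow> v \<le> \<theta> \<Longrightarrow> rate integrable_on {u..v}"
proof -
  assume uv: "0 \<le> u" "v \<le> \<theta>"
  obtain M where M: "\<And>\<tau>. \<tau> \<in> {0..\<theta>} \<Longrightarrow> \<bar>rate \<tau>\<bar> \<le> M" using rate_bounded by metis
  have "a \<in> borel_measurable (lebesgue_on {0..\<theta>})" "p \<in> borel_measurable (lebesgue_on {0..\<theta>})"
    using a_cont p_cont by (auto intro: continuous_imp_measurable_on_sets_lebesgue)
  then have "rate \<in> borel_measurable (lebesgue_on {0..\<theta>})"
    unfolding rate_def using l_meas by measurable
  then have "rate integrable_on {0..\<theta>}"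
    by (rule measurable_bounded_by_integrable_imp_integrable[where g = "\<lambda>_. M"])
      (use M integrable_const_ivl in auto)
  then show ?thesis by (rule integrable_on_subinterval) (use uv in auto)
qed

lemma integral_rate_diff:
  "0 \<le> u \<Longrightarrow> u \<le> v \<Longrightarrow> v \<le> \<theta> \<Longrightarrow> integral {0..v} rate - integral {0..u} rate = integral {u..v} rate"
  using Henstock_Kurzweil_Integration.integral_combine[of 0 u v rate] rate_integrable[of 0 v] by simp

text \<open>At every \<open>u < \<theta>\<close>, and not merely at Lebesgue points of \<open>l\<close>, the difference of \<open>\<omega>\<close> and the integral of
  \<open>rate\<close> has right derivative zero: the averages of \<open>l\<close> over \<open>[u, \<tau>]\<close> cancel, since \<open>l\<close> is bounded
  and \<open>a\<close> and \<open>p\<close> are continuous at \<open>u\<close>.\<close>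

lemma eq_integral_rate:
  assumes t: "t \<in> {0..\<theta>}"
  shows "\<omega> t = \<omega> 0 + integral {0..t} rate"
proof -
  let ?F = "\<lambda>t. \<omega> t - integral {0..t} rate"
  have "?F t = ?F 0"
  proof (rule zero_right_derivative_imp_eq[where f = ?F and a = 0 and b = t])
    show "0 \<le> t" using t by simp
    show "continuous_on {0..t} ?F"
      using t by (intro continuous_intros indefinite_integral_continuous_1 rate_integrable
          continuous_on_subset[OF \<omega>_cont]) auto
    fix u assume "u \<in> {0..<t}"
    with t have u: "0 \<le> u" "u < \<theta>" by auto
    have C: "C \<ge> 0" using l_bound[of 0] norm_ge_zero order_trans by blast
    define X where "X \<tau> = \<bar>(\<omega> \<tau> - \<omega> u) / (\<tau> - u) - a u - p u \<bullet> ((1 / (\<tau> - u)) *\<^sub>R integral {u..\<tau>} l)\<bar>" for \<tau>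
    define q where "q s = \<bar>a s - a u\<bar> + norm (p s - p u) * C" for s
    have q_cont: "continuous_on {0..\<theta>} q"
      unfolding q_def by (intro continuous_intros a_cont p_cont)
    show "((\<lambda>\<tau>. (?F \<tau> - ?F u) / (\<tau> - u)) \<longlongrightarrow> 0) (at_right u)"
    proof (rule tendstoI)
      fix e :: real assume e: "e > 0"
      then obtain d where d: "d > 0" "\<And>s. s \<in> {0..\<theta>} \<Longrightarrow> dist s u < d \<Longrightarrow> dist (q s) (q u) < e / 2"
        using q_cont u unfolding continuous_on_iff
        by (metis atLeastAtMost_iff half_gt_zero less_imp_le)
      have ev1: "eventually (\<lambda>\<tau>. X \<tau> < e / 2) (at_right u)"
        using order_tendstoD(2)[OF quotient[of u], of "e / 2"] u e by (simp add: X_def)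
      have ev2: "eventually (\<lambda>\<tau>. \<tau> \<in> {u<..<min \<theta> (u + d)}) (at_right u)"
        using u d(1) by (intro eventually_at_right_real) auto
      show "eventually (\<lambda>\<tau>. dist ((?F \<tau> - ?F u) / (\<tau> - u)) 0 < e) (at_right u)"
        using ev1 ev2
      proof eventually_elim
        case (elim \<tau>)
        then have \<tau>: "u < \<tau>" "\<tau> < \<theta>" "\<tau> < u + d" by auto
        have int: "rate integrable_on {u..\<tau>}" "l integrable_on {u..\<tau>}"
          using u \<tau> by (auto intro: rate_integrable l_integrable)
        \<comment> \<open>\<open>R\<close> is the error of freezing \<open>a\<close> and \<open>p\<close> at time \<open>u\<close> under the integral.\<close>
        define R where "R = integral {u..\<tau>} (\<lambda>s. rate s - a u - p u \<bullet> l s)"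
        have "((\<lambda>s. rate s - a u - p u \<bullet> l s) has_integral
            integral {u..\<tau>} rate - (\<tau> - u) * a u - p u \<bullet> integral {u..\<tau>} l) {u..\<tau>}"
        proof (intro has_integral_diff)
          show "((\<lambda>_. a u) has_integral (\<tau> - u) * a u) {u..\<tau>}"
            using has_integral_const_real[of "a u" u \<tau>] \<tau> by simp
          show "((\<lambda>s. p u \<bullet> l s) has_integral p u \<bullet> integral {u..\<tau>} l) {u..\<tau>}"
            using has_integral_linear[OF integrable_integral[OF int(2)] bounded_linear_inner_right[of "p u"]]
            by (simp add: comp_def)
        qed (use int in \<open>auto intro: integrable_integral\<close>)
        then have R: "R = integral {u..\<tau>} rate - (\<tau> - u) * a u - p u \<bullet> integral {u..\<tau>} l"
            and R_int: "(\<lambda>s. rate s - a u - p u \<bullet> l s) integrable_on {u..\<tau>}"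
          unfolding R_def by (auto simp: integral_unique)
        have "norm R \<le> integral {u..\<tau>} (\<lambda>_. e / 2)"
          unfolding R_def
        proof (rule Henstock_Kurzweil_Integration.integral_norm_bound_integral[OF R_int])
          show "(\<lambda>_. e / 2) integrable_on {u..\<tau>}" by (rule integrable_const_ivl)
          fix s assume s: "s \<in> {u..\<tau>}"
          have "rate s - a u - p u \<bullet> l s = (a s - a u) + (p s - p u) \<bullet> l s"
            by (simp add: rate_def inner_diff_left)
          also have "norm \<dots> \<le> \<bar>a s - a u\<bar> + \<bar>(p s - p u) \<bullet> l s\<bar>" by simp
          also have "\<bar>(p s - p u) \<bullet> l s\<bar> \<le> norm (p s - p u) * norm (l s)"
            by (rule Cauchy_Schwarz_ineq2)
          also have "\<dots> \<le> norm (p s - p u) * C"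
            by (intro mult_left_mono l_bound) simp
          also have "\<bar>a s - a u\<bar> + norm (p s - p u) * C \<le> e / 2"
            using d(2)[of s] s u \<tau> abs_ge_self[of "\<bar>a s - a u\<bar> + norm (p s - p u) * C"]
            by (simp add: q_def dist_real_def)
          finally show "norm (rate s - a u - p u \<bullet> l s) \<le> e / 2" by simp
        qed
        then have "\<bar>R / (\<tau> - u)\<bar> \<le> e / 2"
          using \<tau> by (simp add: abs_divide divide_simps mult.commute)
        moreover have "(?F \<tau> - ?F u) / (\<tau> - u) =
            ((\<omega> \<tau> - \<omega> u) / (\<tau> - u) - a u - p u \<bullet> ((1 / (\<tau> - u)) *\<^sub>R integral {u..\<tau>} l)) - R / (\<tau> - u)"
        proof -
          define h where "h = \<tau> - u"
          have "h \<noteq> 0" using \<tau> by (simp add: h_def)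
          have F: "?F \<tau> - ?F u = (\<omega> \<tau> - \<omega> u) - integral {u..\<tau>} rate"
            using integral_rate_diff[of u \<tau>] u \<tau> by simp
          show ?thesis
            unfolding F R h_def[symmetric] using \<open>h \<noteq> 0\<close> by (simp add: diff_divide_distrib)
        qed
        ultimately show ?case
          using elim unfolding X_def dist_real_def by linarith
      qed
    qed
  qed
  then show ?thesis by simp
qed

lemma lipschitz: "\<exists>L. L-lipschitz_on {0..\<theta>} \<omega>"
proof -
  obtain M where M: "\<And>\<tau>. \<tau> \<in> {0..\<theta>} \<Longrightarrow> \<bar>rate \<tau>\<bar> \<le> M" using rate_bounded by metis
  have M_nonneg: "M \<ge> 0" using M[of 0] \<theta> by force
  have le: "\<bar>\<omega> v - \<omega> u\<bar> \<le> M * (v - u)" if "0 \<le> u" "u \<le> v" "v \<le> \<theta>" for u v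
  proof -
    have "\<omega> v - \<omega> u = integral {u..v} rate"
      using that integral_rate_diff[of u v] eq_integral_rate[of u] eq_integral_rate[of v] by simp
    moreover have "norm (integral {u..v} rate) \<le> integral {u..v} (\<lambda>_. M)"
      using that M by (intro Henstock_Kurzweil_Integration.integral_norm_bound_integral
          rate_integrable integrable_const_ivl) auto
    ultimately show ?thesis using that by (simp add: mult.commute)
  qed
  have "M-lipschitz_on {0..\<theta>} \<omega>"
  proof (rule lipschitz_onI)
    fix u v assume "u \<in> {0..\<theta>}" "v \<in> {0..\<theta>}"
    then show "dist (\<omega> u) (\<omega> v) \<le> M * dist u v"
      using le[of u v] le[of v u] by (cases "u \<le> v") (auto simp: dist_real_def abs_minus_commute)
  qed (rule M_nonneg)
  then show ?thesis ..
qed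

lemma has_real_derivative_ae:
  obtains N where "negligible N"
    "\<And>t. t \<in> {0<..<\<theta>} - N \<Longrightarrow> (\<omega> has_real_derivative rate t) (at t)"
proof -
  obtain N where N: "negligible N"
      "\<And>t. t \<in> {0<..<\<theta>} - N \<Longrightarrow> ((\<lambda>\<tau>. integral {0..\<tau>} rate) has_real_derivative rate t) (at t)"
    using indefinite_integral_has_real_derivative_ae[OF rate_integrable[of 0 \<theta>]] by auto
  have "(\<omega> has_real_derivative rate t) (at t)" if t: "t \<in> {0<..<\<theta>} - N" for t
  proof (rule has_field_derivative_transform_within_open)
    show "((\<lambda>\<tau>. \<omega> 0 + integral {0..\<tau>} rate) has_real_derivative rate t) (at t)"
      using DERIV_add[OF DERIV_const N(2)[OF t]] by simp
    show "t \<in> {0<..<\<theta>}" using t by simp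
    show "\<omega> 0 + integral {0..\<tau>} rate = \<omega> \<tau>" if "\<tau> \<in> {0<..<\<theta>}" for \<tau>
      using eq_integral_rate[of \<tau>] that by simp
  qed simp
  with N(1) show ?thesis by (rule that)
qed

end

section \<open>The chain rule for coinvariantly smooth functionals\<close>

text \<open>The Lebesgue integral of an essentially bounded function is the Henstock-Kurzweil integral of
  its bounded version.\<close>

lemma lebesgue_integral_eq_integral_representative:
  fixes l l' :: "real \<Rightarrow> 'a :: euclidean_space"
  assumes l': "l' \<in> borel_measurable (lebesgue_on {0..T})" "\<And>\<xi>. norm (l' \<xi>) \<le> C"
    and N: "negligible N" "\<And>\<xi>. \<xi> \<in> {0..T} - N \<Longrightarrow> l' \<xi> = l \<xi>"
    and uv: "0 \<le> u" "v \<le> T"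
  shows "(LINT \<xi>|lebesgue_on {u..v}. l \<xi>) = integral {u..v} l'"
proof -
  have sub: "{u..v} \<subseteq> {0..T}" using uv by auto
  have "l' absolutely_integrable_on {u..v}"
    by (rule measurable_bounded_by_integrable_imp_absolutely_integrable[where g = "\<lambda>_. C"])
      (use l' sub integrable_const_ivl measurable_restrict_mono[OF l'(1) sub] in auto)
  then have "l absolutely_integrable_on {u..v}"
    by (rule absolutely_integrable_spike[OF _ N(1)]) (use N(2) sub in auto)
  then have "(LINT \<xi>|lebesgue_on {u..v}. l \<xi>) = integral {u..v} l"
    by (intro lebesgue_integral_eq_integral absolutely_integrable_imp_integrable) auto
  also have "\<dots> = integral {u..v} l'"
    by (rule integral_spike[OF N(1)]) (use N(2) sub in auto)
  finally show ?thesis .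
qed

theorem proposition8p1:
  fixes T c \<alpha> \<beta> lam :: real
    and y x :: "real \<Rightarrow> real ^ 'n"
    and K Kst :: "real \<times> real \<Rightarrow> real ^ 'n ^ 'n"
    and \<phi> :: "real \<times> (real \<Rightarrow> real ^ 'n) \<Rightarrow> real"
    and \<omega> :: "real \<Rightarrow> real"
  assumes T_pos: "T > 0" and c_pos: "c > 0"
    and y_cont: "continuous_on {0..T} y"
    and alpha: "0 < \<alpha>" "\<alpha> < 1"
    and Kst_cont: "continuous_on (Omega T) Kst"
    and beta: "0 < \<beta>" "\<beta> \<le> 1" and lam_pos: "lam > 0"
    and Kst_hoelder:
      "\<And>\<tau> \<xi> \<xi>'. (\<tau>, \<xi>) \<in> Omega T \<Longrightarrow> (\<tau>, \<xi>') \<in> Omega T \<Longrightarrow>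
         onorm ((*v) (Kst (\<tau>, \<xi>) - Kst (\<tau>, \<xi>'))) \<le> lam * \<bar>\<xi> - \<xi>'\<bar> powr \<beta>"
    and K_eq:
      "\<And>\<tau> \<xi>. (\<tau>, \<xi>) \<in> Omega_open T \<Longrightarrow>
         K (\<tau>, \<xi>) = (1 / (\<tau> - \<xi>) powr (1 - \<alpha>)) *\<^sub>R Kst (\<tau>, \<xi>)"
    and K_unique:
      "\<And>t l. 0 < t \<Longrightarrow> t \<le> T \<Longrightarrow> l \<in> Linf t \<Longrightarrow> (\<forall>\<tau>\<in>{0..t}. volterra K l \<tau> = 0) \<Longrightarrow>
         AE \<xi> in lebesgue_on {0..t}. l \<xi> = 0"
    and smooth: "ci_smooth T y K c \<phi>"
    and x: "x \<in> motions y K T"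
    and omega: "\<And>\<tau>. \<tau> \<in> {0..T} \<Longrightarrow> \<omega> \<tau> = \<phi> (\<tau>, restrict x {0..\<tau>})"
  shows "continuous_on {0..T} \<omega> \<and>
    (\<forall>\<theta>\<in>{0<..<T}. \<exists>L. L-lipschitz_on {0..\<theta>} \<omega>) \<and>
    (AE \<tau> in lebesgue_on {0..T}.
      (\<omega> has_real_derivative
        (ci_dt T y K \<phi> (\<tau>, restrict x {0..\<tau>}) +
         ci_grad T y K \<phi> (\<tau>, restrict x {0..\<tau>}) \<bullet> ell y K T x \<tau>))
      (at \<tau> within {0..T}))"
proof -
  interpret volterra_positions T \<alpha> K Kst y
    by unfold_locales (fact T_pos y_cont alpha Kst_cont K_eq K_unique)+
  define l where "l = ell y K T x"
  define a where "a \<tau> = ci_dt T y K \<phi> (\<tau>, restrict x {0..\<tau>})" for \<tau>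
  define p where "p \<tau> = ci_grad T y K \<phi> (\<tau>, restrict x {0..\<tau>})" for \<tau>
  obtain k where k: "\<And>t. t \<in> {0..T} \<Longrightarrow> (t, restrict x {0..t}) \<in> positions_k T y K c k"
    using restrict_positions_k[OF x c_pos] by metis
  have before: "(t, restrict x {0..t}) \<in> positions_before T y K" if "t \<in> {0..<T}" for t
    using that restrict_position[OF x, of t] by (simp add: positions_before_def)

  have "continuous_on {0..T} (\<lambda>\<tau>. \<phi> (\<tau>, restrict x {0..\<tau>}))"
    using smooth k by (intro continuous_on_along_motion[OF x]) (auto simp: ci_smooth_def)
  then have \<omega>_cont: "continuous_on {0..T} \<omega>"
    by (rule continuous_on_eq) (simp add: omega)
  have a_cont: "continuous_on {0..<T} a"
    unfolding a_def using smooth k before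
    by (intro continuous_on_along_motion[OF x, where Z = "positions_k T y K c k \<inter> positions_before T y K"])
      (auto simp: ci_smooth_def)
  have p_cont: "continuous_on {0..<T} p"
    unfolding p_def using smooth k before
    by (intro continuous_on_along_motion[OF x, where Z = "positions_k T y K c k \<inter> positions_before T y K"])
      (auto simp: ci_smooth_def)

  have "l \<in> Linf T"
    using represents_ell[OF x] T_pos by (simp add: l_def represents_def)
  then obtain l' N C where l': "l' \<in> borel_measurable (lebesgue_on {0..T})" "\<And>\<xi>. norm (l' \<xi>) \<le> C"
      and N: "negligible N" "\<And>\<xi>. \<xi> \<in> {0..T} - N \<Longrightarrow> l' \<xi> = l \<xi>"
    using Linf_bounded_representative by metis

  have quotient: "((\<lambda>\<tau>. \<bar>(\<omega> \<tau> - \<omega> t) / (\<tau> - t) - a t - p t \<bullet> ((1 / (\<tau> - t)) *\<^sub>R integral {t..\<tau>} l')\<bar>)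
        \<longlongrightarrow> 0) (at_right t)" if t: "t \<in> {0..<T}" for t
  proof -
    let ?z = "(t, restrict x {0..t})"
    have "\<exists>D. has_ci_derivative T y K \<phi> ?z D"
      using smooth before[OF t] by (simp add: ci_smooth_def ci_differentiable_def)
    then have "has_ci_derivative T y K \<phi> ?z (ci_derivs T y K \<phi> ?z)"
      unfolding ci_derivs_def by (rule someI_ex)
    then have "has_ci_derivative T y K \<phi> ?z (a t, p t)"
      by (simp add: a_def p_def ci_dt_def ci_grad_def)
    moreover have "x \<in> extensions T y K t (restrict x {0..t})"
      using x by (simp add: extensions_def)
    ultimately have lim: "((\<lambda>\<tau>. \<bar>(\<phi> (\<tau>, restrict x {0..\<tau>}) - \<phi> ?z) / (\<tau> - t) - a t
              - p t \<bullet> ((1 / (\<tau> - t)) *\<^sub>R (LINT \<xi>|lebesgue_on {t..\<tau>}. l \<xi>))\<bar>) \<longlongrightarrow> 0) (at_right t)"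
      by (simp add: has_ci_derivative_def l_def)
    have "eventually (\<lambda>\<tau>. \<tau> \<in> {t<..<T}) (at_right t)"
      using t by (intro eventually_at_right_real) auto
    then show ?thesis
    proof (rule Lim_transform_eventually[OF lim, OF eventually_mono])
      fix \<tau> assume "\<tau> \<in> {t<..<T}"
      moreover from this t have "(LINT \<xi>|lebesgue_on {t..\<tau>}. l \<xi>) = integral {t..\<tau>} l'"
        by (intro lebesgue_integral_eq_integral_representative[OF l' N]) auto
      ultimately show "\<bar>(\<phi> (\<tau>, restrict x {0..\<tau>}) - \<phi> ?z) / (\<tau> - t) - a t
              - p t \<bullet> ((1 / (\<tau> - t)) *\<^sub>R (LINT \<xi>|lebesgue_on {t..\<tau>}. l \<xi>))\<bar>
          = \<bar>(\<omega> \<tau> - \<omega> t) / (\<tau> - t) - a t - p t \<bullet> ((1 / (\<tau> - t)) *\<^sub>R integral {t..\<tau>} l')\<bar>"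
        using t by (simp add: omega)
    qed
  qed

  have chain: "nonanticipative_chain_rule \<omega> a p l' \<theta> C" if \<theta>: "\<theta> \<in> {0..<T}" for \<theta>
  proof
    have "{0..\<theta>} \<subseteq> {0..<T}" using \<theta> by auto
    then show "continuous_on {0..\<theta>} a" "continuous_on {0..\<theta>} p"
      using a_cont p_cont continuous_on_subset by blast+
    show "continuous_on {0..\<theta>} \<omega>"
      by (rule continuous_on_subset[OF \<omega>_cont]) (use \<theta> in auto)
    show "l' \<in> borel_measurable (lebesgue_on {0..\<theta>})"
      by (rule measurable_restrict_mono[OF l'(1)]) (use \<theta> in auto)
  qed (use \<theta> l'(2) quotient in auto)

  have "\<exists>L. L-lipschitz_on {0..\<theta>} \<omega>" if "\<theta> \<in> {0<..<T}" for \<theta>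
    using that by (intro nonanticipative_chain_rule.lipschitz[OF chain]) auto
  moreover have "AE \<tau> in lebesgue_on {0..T}. (\<omega> has_real_derivative (a \<tau> + p \<tau> \<bullet> l \<tau>)) (at \<tau> within {0..T})"
  proof -
    \<comment> \<open>The derivatives \<open>a\<close> and \<open>p\<close> are controlled only on compact subintervals of \<open>[0, T)\<close>, which is
      exhausted by countably many of them.\<close>
    define \<theta> where "\<theta> n = T - T / real (n + 2)" for n
    have \<theta>: "\<theta> n \<in> {0..<T}" for n using T_pos by (simp add: \<theta>_def field_simps)
    have "\<exists>M. negligible M \<and>
        (\<forall>t\<in>{0<..<\<theta> n} - M. (\<omega> has_real_derivative (a t + p t \<bullet> l' t)) (at t))" for n
      using nonanticipative_chain_rule.has_real_derivative_ae[OF chain[OF \<theta>[of n]]]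
      unfolding nonanticipative_chain_rule.rate_def[OF chain[OF \<theta>[of n]]] by metis
    then obtain M where M: "\<And>n. negligible (M n)"
        "\<And>n t. t \<in> {0<..<\<theta> n} - M n \<Longrightarrow> (\<omega> has_real_derivative (a t + p t \<bullet> l' t)) (at t)"
      by metis
    let ?E = "{0, T} \<union> N \<union> (\<Union>n. M n)"
    have "negligible ?E"
      using N(1) M(1) by (intro negligible_Un negligible_Union_nat) auto
    moreover have "(\<omega> has_real_derivative (a \<tau> + p \<tau> \<bullet> l \<tau>)) (at \<tau> within {0..T})"
      if \<tau>: "\<tau> \<in> {0..T} - ?E" for \<tau>
    proof -
      have \<tau>T: "0 < \<tau>" "\<tau> < T" using \<tau> by auto
      obtain n where "T / (T - \<tau>) < real n" using reals_Archimedean2 by blast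
      then have "T < (T - \<tau>) * real (n + 2)" using \<tau>T by (simp add: field_simps)
      then have "\<tau> < \<theta> n" by (simp add: \<theta>_def field_simps)
      with \<tau> \<tau>T have "(\<omega> has_real_derivative (a \<tau> + p \<tau> \<bullet> l' \<tau>)) (at \<tau>)" by (intro M(2)[of _ n]) auto
      moreover have "l' \<tau> = l \<tau>" using \<tau> by (intro N(2)) auto
      ultimately show ?thesis by (simp add: has_field_derivative_at_within)
    qed
    ultimately show ?thesis
      by (auto simp: AE_restrict_space_iff negligible_iff_null_sets intro!: AE_I'[of ?E])
  qed
  ultimately show ?thesis
    using \<omega>_cont by (simp add: a_def p_def l_def)
qed

end
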